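(* For every integer $d\geq 1$, all $\sigma>0$ and $p>0$, define $$t_0=\frac{2(d+1)\cdot 4^{\frac{p}{d+1}}}{e\,p\cdot W\bigl(\frac{d+1}{p\sigma^2}\bigr)}\exp\Bigl(\frac{1}{W\bigl(\frac{d+1}{p\sigma^2}\bigr)}\Bigr).$$ Then for all integers $d\geq 1$, all $\sigma>0$, all $p>0$, and all $0<\varepsilon\leq 1$ we have $$\mathcal{H}\bigl(\mathrm{Id}: H_\sigma(B_2^d)\to\ell_\infty(B_2^d),\,\varepsilon\bigr)\leq\binom{t_0+d}{d}\cdot\frac{d+1}{e\,p}\cdot 4^{\frac{p}{d+1}}\cdot\varepsilon^{-p}.$$
   Context: $B_2^d\subseteq\mathbb{R}^d$ denotes the closed Euclidean unit ball. For $\sigma>0$ and $X\subseteq\mathbb{R}^d$, $H_\sigma(X)$ is the reproducing kernel Hilbert space (of real-valued functions on $X$) of the isotropic Gaussian kernel $k_\sigma(x,x')=\exp(-\sigma^2\|x-x'\|_{\ell_2^d}^2)$, $x,x'\in X$, where $\|\cdot\|_{\ell_2^d}$ is the Euclidean norm. $\ell_\infty(X)$ is the Banach space of bounded functions $f:X\to\mathbb{R}$ with the supremum norm, and $\mathrm{Id}$ is the canonical embedding $f\mapsto f$. For a bounded subset $A$ of a Banach space $E$ with closed unit ball $B_E$, the covering numbers are $\mathcal{N}(A,\varepsilon)=\min\{n\in\{1,2,\ldots\}: \exists x_1,\ldots,x_n\in E \text{ with } A\subseteq\bigcup_{i=1}^n (x_i+\varepsilon B_E)\}$, $\varepsilon>0$.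 For a bounded linear operator $T:E\to F$ between Banach spaces, the log-covering numbers are $\mathcal{H}(T,\varepsilon)=\log\mathcal{N}(T B_E,\varepsilon)$, with $\log$ the natural logarithm. For real $t>0$ and integer $d\geq1$ the generalized binomial coefficient is $\binom{t+d}{d}=\frac{1}{d!}\prod_{i=1}^d(t+i)$. $W:[-1/e,\infty)\to[-1,\infty)$ is the upper (principal) branch of Lambert's $W$-function, i.e. the inverse of $t\mapsto te^t$ on $[-1,\infty)$. *)

theory Defs
  imports "HOL-Analysis.Analysis" "HOL-Library.Function_Algebras"
begin

instantiation "fun" :: (type, real_vector) real_vector
begin

definition scaleR_fun :: "real \<Rightarrow> ('a \<Rightarrow> 'b) \<Rightarrow> 'a \<Rightarrow> 'b"
  where "scaleR_fun c f = (\<lambda>x. c *\<^sub>R f x)"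

instance
  by standard (simp_all add: scaleR_fun_def fun_eq_iff scaleR_add_right scaleR_add_left)

end

text \<open>
  Function spaces over different sets \<open>X\<close> are linear subspaces of the type of all functions,
  so a normed space is given by a carrier together with a norm, and a Hilbert space by a carrier
  together with an inner product. Neither the norm nor the inner product is constrained off
  the carrier. A function on \<open>X\<close> is represented by its extension by \<open>0\<close>.
\<close>

definition functions_on :: "'a set \<Rightarrow> ('a \<Rightarrow> real) set"
  where "functions_on X = {f. \<forall>x. x \<notin> X \<longrightarrow> f x = 0}"

definition ip_norm :: "('v \<Rightarrow> 'v \<Rightarrow> real) \<Rightarrow> 'v \<Rightarrow> real"
  where "ip_norm ip f = sqrt (ip f f)"

locale hilbert_space_on =
  fixes H :: "'v::real_vector set" and ip :: "'v \<Rightarrow> 'v \<Rightarrow> real"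
  assumes subspace: "subspace H"
    and ip_commute: "\<lbrakk>f \<in> H; g \<in> H\<rbrakk> \<Longrightarrow> ip f g = ip g f"
    and ip_add_left: "\<lbrakk>f \<in> H; g \<in> H; h \<in> H\<rbrakk> \<Longrightarrow> ip (f + g) h = ip f h + ip g h"
    and ip_scaleR_left: "\<lbrakk>f \<in> H; g \<in> H\<rbrakk> \<Longrightarrow> ip (c *\<^sub>R f) g = c * ip f g"
    and ip_pos: "\<lbrakk>f \<in> H; f \<noteq> 0\<rbrakk> \<Longrightarrow> ip f f > 0"
    and complete: "\<lbrakk>\<And>n. s n \<in> H;
        \<And>e. e > 0 \<Longrightarrow> \<exists>M. \<forall>m\<ge>M. \<forall>n\<ge>M. ip_norm ip (s m - s n) < e\<rbrakk>
      \<Longrightarrow> \<exists>f\<in>H. (\<lambda>n. ip_norm ip (s n - f)) \<longlonglongrightarrow> 0"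

text \<open>
  By the Moore--Aronszajn theorem, a positive semidefinite kernel \<open>k\<close> on \<open>X\<close> has exactly one
  reproducing kernel Hilbert space: \<open>H\<close>, and \<open>ip\<close> on \<open>H\<close>, are determined by \<open>X\<close> and \<open>k\<close>.
\<close>

locale rkhs = hilbert_space_on H ip
  for X :: "'a set" and k :: "'a \<Rightarrow> 'a \<Rightarrow> real"
    and H :: "('a \<Rightarrow> real) set" and ip :: "('a \<Rightarrow> real) \<Rightarrow> ('a \<Rightarrow> real) \<Rightarrow> real" +
  assumes vanish_off: "H \<subseteq> functions_on X"
    and kernel_mem: "x \<in> X \<Longrightarrow> (\<lambda>y. if y \<in> X then k x y else 0) \<in> H"
    and reproducing: "\<lbrakk>f \<in> H; x \<in> X\<rbrakk> \<Longrightarrow> f x = ip f (\<lambda>y. if y \<in> X then k x y else 0)"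

definition gaussian_kernel :: "real \<Rightarrow> 'a::euclidean_space \<Rightarrow> 'a \<Rightarrow> real"
  where "gaussian_kernel \<sigma> x y = exp (- \<sigma>\<^sup>2 * (norm (x - y))\<^sup>2)"

definition linf :: "'a set \<Rightarrow> ('a \<Rightarrow> real) set"
  where "linf X = {f \<in> functions_on X. bounded (f ` X)}"

definition linf_norm :: "'a set \<Rightarrow> ('a \<Rightarrow> real) \<Rightarrow> real"
  where "linf_norm X f = (SUP x\<in>X. \<bar>f x\<bar>)"

definition unit_ball :: "'v set \<Rightarrow> ('v \<Rightarrow> real) \<Rightarrow> 'v set"
  where "unit_ball E nrm = {x \<in> E. nrm x \<le> 1}"

text \<open>The value is \<open>\<infinity>\<close> if no finite cover exists.\<close>

definition covering_number ::
    "'v::real_vector set \<Rightarrow> ('v \<Rightarrow> real) \<Rightarrow> 'v set \<Rightarrow> real \<Rightarrow> enat"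
  where "covering_number E nrm A \<epsilon> =
    Inf {enat n | n. n \<ge> 1 \<and>
      (\<exists>x. (\<forall>i\<in>{1..n}. x i \<in> E) \<and>
        A \<subseteq> (\<Union>i\<in>{1..n}. {x i + \<epsilon> *\<^sub>R b | b. b \<in> unit_ball E nrm}))}"

definition log_covering_number ::
    "'u set \<Rightarrow> ('u \<Rightarrow> real) \<Rightarrow> 'v::real_vector set \<Rightarrow> ('v \<Rightarrow> real)
      \<Rightarrow> ('u \<Rightarrow> 'v) \<Rightarrow> real \<Rightarrow> ereal"
  where "log_covering_number E nE F nF T \<epsilon> =
    (case covering_number F nF (T ` unit_ball E nE) \<epsilon> of
       enat n \<Rightarrow> ereal (ln (real n)) | \<infinity> \<Rightarrow> \<infinity>)"

definition gen_binomial :: "real \<Rightarrow> nat \<Rightarrow> real"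
  \<comment> \<open>\<open>gen_binomial t d\<close> is the binomial coefficient "\<open>t + d\<close> over \<open>d\<close>"\<close>
  where "gen_binomial t d = 1 / fact d * (\<Prod>i=1..d. t + real i)"

definition lambert_W :: "real \<Rightarrow> real"
  where "lambert_W = the_inv_into {-1..} (\<lambda>t. t * exp t)"

end

theory Submission
  imports Defs
begin

text \<open>
  With \<open>E x = exp (- \<sigma>\<^sup>2 \<parallel>x\<parallel>\<^sup>2)\<close> the kernel factors as
  \<open>E x * E y * exp (2 \<sigma>\<^sup>2 \<langle>x, y\<rangle>)\<close>, and expanding the last exponential splits it into layers, one
  for each degree of homogeneity, each of which is positive semidefinite. The layers of degree
  below \<open>n\<close> form a kernel of rank \<open>n - 1 + d\<close> over \<open>d\<close>, the number of monomials; on the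
  diagonal over the unit ball the remaining layers add up to at most
  \<open>(2 \<sigma>\<^sup>2)\<^sup>n / n!\<close>, by Taylor's formula (\<open>gaussian_minus_low_kernel_diagonal\<close>). Hence a function
  in the unit ball of the Hilbert space is, uniformly up to the square root of this number, a
  combination of the features of degree below \<open>n\<close> that is itself bounded by 1.

  The coefficients come from finite sets of points. A function of norm at most 1 agrees on any
  finite set \<open>F\<close> with a combination of kernel sections at points of \<open>F\<close> whose quadratic form is
  at most 1 (\<open>unit_ball_on_finite\<close>). The splitting of such a combination into low and high
  degrees is controlled on \<open>F\<close> by the Cauchy--Schwarz inequality for the two partial kernels
  (\<open>finite_feature_approximation\<close>). The coefficients of the low part lie in a fixed compact
  cube, so a choice of coefficients that works on every finite set works on the whole ball
  (\<open>coefficients_by_compactness\<close>).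

  The combinations of \<open>N\<close> fixed functions that are bounded by 1 and have coefficients in
  \<open>[-1, 1]\<close> admit a \<open>\<delta>\<close>-net of at most
  \<open>(1 + 2 / \<delta>)\<^sup>N\<close> elements (\<open>finite_net_in_span\<close>). Choosing \<open>n\<close> with truncation error at most
  \<open>\<epsilon> / 4\<close> and \<open>\<delta> = 3 \<epsilon> / 4\<close> gives a logarithmic covering number of at most
  \<open>N ln (4 / \<epsilon>)\<close> (\<open>log_covering_number_gaussian_le\<close>). With \<open>q = p / (d + 1)\<close> the logarithm is
  at most \<open>(4 / \<epsilon>) powr q / (e q)\<close>. Any \<open>n \<ge> t0 * \<epsilon> powr (- q)\<close> makes the truncation
  error small enough (\<open>taylor_tail_le_power_minus\<close>). For the least integer
  \<open>n > t0 * \<epsilon> powr (- q)\<close>, the largest degree kept is at most \<open>t0 * \<epsilon> powr (- q)\<close>, and so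
  \<open>N\<close> exceeds the generalized binomial coefficient at \<open>t0\<close> by at most the factor
  \<open>\<epsilon> powr (- q * d)\<close>. The two powers of \<open>\<epsilon>\<close> multiply to \<open>\<epsilon> powr (- p)\<close>.
\<close>

section \<open>Nets of bounded functions in a finite-dimensional space\<close>

text \<open>
  The usual proof compares volumes of balls. Here the comparison is iterated instead: with
  \<open>l = \<delta> / (\<delta> + 2)\<close> the maps \<open>u \<mapsto> (1 - l) * f + l * u\<close> for \<open>f \<in> S\<close> send \<open>A\<close> to subsets of \<open>A\<close>
  that stay a positive distance apart, because the centres \<open>(1 - l) * f\<close> are more than
  \<open>(1 - l) * \<delta> = 2 * l\<close> apart and the copies of \<open>A\<close> have diameter at most \<open>2 * l\<close>. Composing \<open>j\<close>
  such maps gives \<open>card S ^ j\<close> points of \<open>A\<close> at mutual distance at least a constant times \<open>l ^ j\<close>. So a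
  packing bound with the right exponent \<open>N\<close> but an arbitrary constant \<open>C\<close> forces
  \<open>card S * l ^ N \<le> 1\<close>, since the constant disappears as \<open>j\<close> grows.
\<close>

lemma separated_card_bound:
  fixes X :: "'a set" and A S :: "('a \<Rightarrow> real) set"
  assumes conv: "\<And>f g l. f \<in> A \<Longrightarrow> g \<in> A \<Longrightarrow> 0 \<le> l \<Longrightarrow> l \<le> 1 \<Longrightarrow> (\<lambda>x. (1 - l) * f x + l * g x) \<in> A"
    and bdd: "\<And>f x. f \<in> A \<Longrightarrow> x \<in> X \<Longrightarrow> \<bar>f x\<bar> \<le> 1"
    and crude: "\<And>r T. 0 < r \<Longrightarrow> r \<le> 1 \<Longrightarrow> T \<subseteq> A \<Longrightarrow> finite T \<Longrightarrow>
        (\<And>f g. f \<in> T \<Longrightarrow> g \<in> T \<Longrightarrow> f \<noteq> g \<Longrightarrow> \<exists>x\<in>X. r \<le> \<bar>f x - g x\<bar>) \<Longrightarrow> real (card T) \<le> (C / r) ^ N"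
    and S: "S \<subseteq> A" "finite S" and "\<delta> > 0"
    and sep: "\<And>f g. f \<in> S \<Longrightarrow> g \<in> S \<Longrightarrow> f \<noteq> g \<Longrightarrow> \<exists>x\<in>X. \<delta> < \<bar>f x - g x\<bar>"
  shows "real (card S) \<le> (1 + 2 / \<delta>) ^ N"
proof (cases "S = {}")
  case True
  with \<open>\<delta> > 0\<close> show ?thesis by simp
next
  case False
  define l where "l = \<delta> / (\<delta> + 2)"
  have l: "0 < l" "l < 1" and l_delta: "2 * l = (1 - l) * \<delta>" and l_inv: "1 / l = 1 + 2 / \<delta>"
    using \<open>\<delta> > 0\<close> by (simp_all add: l_def field_simps)
  obtain a where a: "a \<in> S" using False by blast
  \<comment> \<open>A margin by which the finitely many distances exceed \<open>\<delta>\<close>, rescaled by \<open>1 - l\<close>.\<close>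
  have "\<exists>g>0. g \<le> 1 \<and> (\<forall>f\<in>S. \<forall>h\<in>S. f \<noteq> h \<longrightarrow> (\<exists>x\<in>X. \<delta> + g / (1 - l) \<le> \<bar>f x - h x\<bar>))"
  proof -
    define P where "P = {(f, h). f \<in> S \<and> h \<in> S \<and> f \<noteq> h}"
    have finP: "finite P" by (rule finite_subset[of _ "S \<times> S"]) (auto simp: P_def S)
    have "\<forall>u\<in>P. \<exists>x. x \<in> X \<and> \<delta> < \<bar>fst u x - snd u x\<bar>"
      using sep by (fastforce simp: P_def)
    then obtain x where x: "\<And>u. u \<in> P \<Longrightarrow> x u \<in> X \<and> \<delta> < \<bar>fst u (x u) - snd u (x u)\<bar>" by metis
    define G where "G = insert 1 ((\<lambda>u. (1 - l) * (\<bar>fst u (x u) - snd u (x u)\<bar> - \<delta>)) ` P)"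
    have G: "finite G" "G \<noteq> {}" "\<And>v. v \<in> G \<Longrightarrow> v > 0" using finP x l by (auto simp: G_def)
    show ?thesis
    proof (rule exI[of _ "Min G"], intro conjI ballI impI)
      show "Min G > 0" using G by (simp add: Min_gr_iff)
      show "Min G \<le> 1" using G by (auto simp: G_def intro!: Min_le)
      fix f h assume fh: "f \<in> S" "h \<in> S" "f \<noteq> h"
      then have u: "(f, h) \<in> P" by (simp add: P_def)
      then have "Min G \<le> (1 - l) * (\<bar>f (x (f, h)) - h (x (f, h))\<bar> - \<delta>)"
        using G by (force simp: G_def intro!: Min_le)
      then have "\<delta> + Min G / (1 - l) \<le> \<bar>f (x (f, h)) - h (x (f, h))\<bar>"
        using l by (simp add: field_simps)
      with x[OF u] show "\<exists>x\<in>X. \<delta> + Min G / (1 - l) \<le> \<bar>f x - h x\<bar>" by auto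
    qed
  qed
  then obtain g where g: "g > 0" "g \<le> 1"
    and gap: "\<And>f h. f \<in> S \<Longrightarrow> h \<in> S \<Longrightarrow> f \<noteq> h \<Longrightarrow> \<exists>x\<in>X. \<delta> + g / (1 - l) \<le> \<bar>f x - h x\<bar>" by blast
  have far: "\<exists>x\<in>X. g \<le> \<bar>((1 - l) * f x + l * u x) - ((1 - l) * h x + l * v x)\<bar>"
    if fh: "f \<in> S" "h \<in> S" "f \<noteq> h" and uv: "u \<in> A" "v \<in> A" for f h u v
  proof -
    obtain x where x: "x \<in> X" "\<delta> + g / (1 - l) \<le> \<bar>f x - h x\<bar>" using gap[OF fh] by blast
    have "(1 - l) * \<delta> + g \<le> (1 - l) * \<bar>f x - h x\<bar>"
      using mult_left_mono[OF x(2), of "1 - l"] l by (simp add: distrib_left)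
    also have "\<dots> = \<bar>(1 - l) * (f x - h x)\<bar>" using l by (simp add: abs_mult)
    finally have 1: "2 * l + g \<le> \<bar>(1 - l) * (f x - h x)\<bar>" using l_delta by simp
    have "\<bar>u x - v x\<bar> \<le> 2" using bdd[OF uv(1) x(1)] bdd[OF uv(2) x(1)] by linarith
    then have 2: "\<bar>l * (u x - v x)\<bar> \<le> 2 * l" using l by (simp add: abs_mult)
    have "((1 - l) * f x + l * u x) - ((1 - l) * h x + l * v x) = (1 - l) * (f x - h x) + l * (u x - v x)"
      by (simp add: algebra_simps)
    then show ?thesis using 1 2 x(1) by (intro bexI[of _ x]) linarith+
  qed
  have tower: "\<exists>T\<subseteq>A. finite T \<and> card T = card S ^ j \<and>
      (\<forall>f\<in>T. \<forall>h\<in>T. f \<noteq> h \<longrightarrow> (\<exists>x\<in>X. g * l ^ j \<le> \<bar>f x - h x\<bar>))" for j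
  proof (induction j)
    case 0
    show ?case using a S by (intro exI[of _ "{a}"]) auto
  next
    case (Suc j)
    then obtain T where T: "T \<subseteq> A" "finite T" "card T = card S ^ j"
      and sT: "\<And>f h. f \<in> T \<Longrightarrow> h \<in> T \<Longrightarrow> f \<noteq> h \<Longrightarrow> \<exists>x\<in>X. g * l ^ j \<le> \<bar>f x - h x\<bar>" by blast
    define m where "m = (\<lambda>(f, u) (x::'a). (1 - l) * f x + l * u x :: real)"
    have apart: "\<exists>x\<in>X. g * l ^ Suc j \<le> \<bar>m p x - m q x\<bar>"
      if pq: "p \<in> S \<times> T" "q \<in> S \<times> T" "p \<noteq> q" for p q
    proof -
      obtain f u h v where p: "p = (f, u)" and q: "q = (h, v)" by fastforce
      have mem: "f \<in> S" "h \<in> S" "u \<in> T" "v \<in> T" using pq by (auto simp: p q)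
      show ?thesis
      proof (cases "f = h")
        case True
        then have "u \<noteq> v" using pq by (auto simp: p q)
        then obtain x where x: "x \<in> X" "g * l ^ j \<le> \<bar>u x - v x\<bar>" using sT mem by blast
        have "m p x - m q x = l * (u x - v x)" using True by (simp add: m_def p q algebra_simps)
        then have "\<bar>m p x - m q x\<bar> = l * \<bar>u x - v x\<bar>" using l by (simp add: abs_mult)
        moreover have "l * (g * l ^ j) \<le> l * \<bar>u x - v x\<bar>" using x l by (intro mult_left_mono) auto
        ultimately show ?thesis using x(1) by (intro bexI[of _ x]) (auto simp: algebra_simps)
      next
        case False
        have "u \<in> A" "v \<in> A" using mem T by auto
        from far[OF mem(1,2) False this]
        obtain x where x: "x \<in> X" "g \<le> \<bar>m p x - m q x\<bar>" by (auto simp: m_def p q)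
        have "g * l ^ Suc j \<le> g" using g l by (intro mult_left_le power_le_one) auto
        with x show ?thesis by (meson order_trans)
      qed
    qed
    have pos: "0 < g * l ^ Suc j" using g l by simp
    have inj: "inj_on m (S \<times> T)"
      using apart pos by (intro inj_onI) (metis abs_zero diff_self not_le)
    show ?case
    proof (intro exI[of _ "m ` (S \<times> T)"] conjI ballI impI)
      show "m ` (S \<times> T) \<subseteq> A" using S T l by (auto simp: m_def intro!: conv)
      show "finite (m ` (S \<times> T))" using S T by simp
      show "card (m ` (S \<times> T)) = card S ^ Suc j" using inj T by (simp add: card_image card_cartesian_product)
    qed (use apart in blast)
  qed
  have bound: "(real (card S) * l ^ N) ^ j \<le> (C / g) ^ N" for j
  proof -
    obtain T where T: "T \<subseteq> A" "finite T" "card T = card S ^ j"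
      and sT: "\<And>f h. f \<in> T \<Longrightarrow> h \<in> T \<Longrightarrow> f \<noteq> h \<Longrightarrow> \<exists>x\<in>X. g * l ^ j \<le> \<bar>f x - h x\<bar>"
      using tower[of j] by blast
    have r: "0 < g * l ^ j" "g * l ^ j \<le> 1" using g l by (auto intro!: mult_le_one power_le_one)
    have "real (card S) ^ j = real (card T)" by (simp only: T(3) of_nat_power)
    also have "\<dots> \<le> (C / (g * l ^ j)) ^ N" by (rule crude[OF r T(1,2) sT])
    also have "\<dots> = (C / g) ^ N / (l ^ N) ^ j"
      by (simp only: power_divide power_mult_distrib divide_divide_eq_left power_mult[symmetric] mult.commute[of j N])
    finally have "real (card S) ^ j * (l ^ N) ^ j \<le> (C / g) ^ N"
      using l by (simp only: pos_le_divide_eq zero_less_power)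
    then show ?thesis by (simp only: power_mult_distrib)
  qed
  have "real (card S) * l ^ N \<le> 1"
  proof (rule ccontr)
    assume "\<not> ?thesis"
    then obtain j where "(C / g) ^ N < (real (card S) * l ^ N) ^ j"
      using real_arch_pow[of "real (card S) * l ^ N"] by auto
    with bound[of j] show False by simp
  qed
  then have "real (card S) \<le> (1 / l) ^ N" using l by (simp add: field_simps power_one_over)
  then show ?thesis by (simp add: l_inv)
qed

text \<open>
  A maximal subset of \<open>A\<close> with mutual distances above \<open>\<delta>\<close> is the net. The packing bound with an arbitrary constant,
  which the previous lemma sharpens, comes from rounding the coefficients, which lie in \<open>[-1, 1]\<close>, to
  a grid.
\<close>

lemma finite_net_in_span:
  fixes b :: "'i \<Rightarrow> 'a \<Rightarrow> real" and X :: "'a set"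
  assumes "finite I" and b: "\<And>i. i \<in> I \<Longrightarrow> bounded (b i ` X)" and "\<delta> > 0"
  defines "A \<equiv> {g. (\<forall>x\<in>X. \<bar>g x\<bar> \<le> 1) \<and> (\<exists>w. (\<forall>i\<in>I. \<bar>w i\<bar> \<le> 1) \<and> g = (\<lambda>x. \<Sum>i\<in>I. w i * b i x))}"
  shows "\<exists>S\<subseteq>A. finite S \<and> S \<noteq> {} \<and> real (card S) \<le> (1 + 2 / \<delta>) ^ card I \<and>
    (\<forall>g\<in>A. \<exists>h\<in>S. \<forall>x\<in>X. \<bar>g x - h x\<bar> \<le> \<delta>)"
proof -
  have conv: "(\<lambda>x. (1 - l) * f x + l * g x) \<in> A" if fg: "f \<in> A" "g \<in> A" and l: "0 \<le> l" "l \<le> 1" for f g l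
  proof -
    have mix: "\<bar>(1 - l) * s + l * t\<bar> \<le> 1" if "\<bar>s\<bar> \<le> 1" "\<bar>t\<bar> \<le> 1" for s t :: real
    proof -
      have "\<bar>(1 - l) * s + l * t\<bar> \<le> (1 - l) * \<bar>s\<bar> + l * \<bar>t\<bar>"
        using abs_triangle_ineq[of "(1 - l) * s" "l * t"] l by (simp add: abs_mult)
      also have "\<dots> \<le> (1 - l) * 1 + l * 1" using that l by (intro add_mono mult_left_mono) auto
      finally show ?thesis by simp
    qed
    obtain v w where v: "\<forall>i\<in>I. \<bar>v i\<bar> \<le> 1" "f = (\<lambda>x. \<Sum>i\<in>I. v i * b i x)"
      and w: "\<forall>i\<in>I. \<bar>w i\<bar> \<le> 1" "g = (\<lambda>x. \<Sum>i\<in>I. w i * b i x)" using fg by (auto simp: A_def)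
    have "(\<lambda>x. (1 - l) * f x + l * g x) = (\<lambda>x. \<Sum>i\<in>I. ((1 - l) * v i + l * w i) * b i x)"
      by (simp add: v w sum_distrib_left sum.distrib[symmetric] algebra_simps)
    moreover have "\<forall>i\<in>I. \<bar>(1 - l) * v i + l * w i\<bar> \<le> 1" using v w mix by blast
    moreover have "\<forall>x\<in>X. \<bar>(1 - l) * f x + l * g x\<bar> \<le> 1" using fg mix by (auto simp: A_def)
    ultimately show ?thesis
      unfolding A_def by (intro CollectI conjI exI[of _ "\<lambda>i. (1 - l) * v i + l * w i"])
  qed
  have "\<forall>i\<in>I. \<exists>B. \<forall>x\<in>X. \<bar>b i x\<bar> \<le> B" using b by (force simp: bounded_iff)
  then obtain B0 where B0: "\<And>i x. i \<in> I \<Longrightarrow> x \<in> X \<Longrightarrow> \<bar>b i x\<bar> \<le> B0 i" by metis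
  define B where "B = 1 + (\<Sum>i\<in>I. \<bar>B0 i\<bar>)"
  have B: "(\<Sum>i\<in>I. \<bar>b i x\<bar>) < B" if "x \<in> X" for x
  proof -
    have "(\<Sum>i\<in>I. \<bar>b i x\<bar>) \<le> (\<Sum>i\<in>I. \<bar>B0 i\<bar>)"
      using B0[OF _ that] by (intro sum_mono) (meson abs_ge_self order_trans)
    then show ?thesis by (simp add: B_def)
  qed
  have B1: "B \<ge> 1" by (simp add: B_def sum_nonneg)
  have crude: "real (card T) \<le> ((2 * B + 3) / r) ^ card I"
    if r: "0 < r" "r \<le> 1" and T: "T \<subseteq> A" "finite T"
      and sep: "\<And>f g. f \<in> T \<Longrightarrow> g \<in> T \<Longrightarrow> f \<noteq> g \<Longrightarrow> \<exists>x\<in>X. r \<le> \<bar>f x - g x\<bar>" for r T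
  proof -
    define M where "M = \<lceil>B / r\<rceil>"
    have M: "B / r \<le> M" "M \<le> B / r + 1" by (simp_all add: M_def)
    have "B / r > 0" using B1 r by simp
    then have M0: "real_of_int M > 0" using M by linarith
    have "\<forall>f\<in>T. \<exists>w. (\<forall>i\<in>I. \<bar>w i\<bar> \<le> 1) \<and> f = (\<lambda>x. \<Sum>i\<in>I. w i * b i x)" using T by (auto simp: A_def)
    then obtain w where w: "\<And>f i. f \<in> T \<Longrightarrow> i \<in> I \<Longrightarrow> \<bar>w f i\<bar> \<le> 1"
      and fw: "\<And>f. f \<in> T \<Longrightarrow> f = (\<lambda>x. \<Sum>i\<in>I. w f i * b i x)" by metis
    define G where "G = (\<lambda>f. \<lambda>i\<in>I. \<lfloor>w f i * M\<rfloor>)"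
    \<comment> \<open>Equal rounded coefficients make two functions differ by less than \<open>r\<close>.\<close>
    have inj: "inj_on G T"
    proof (rule inj_onI, rule ccontr)
      fix f g assume fg: "f \<in> T" "g \<in> T" "G f = G g" "f \<noteq> g"
      then obtain x where x: "x \<in> X" "r \<le> \<bar>f x - g x\<bar>" using sep by blast
      have d: "\<bar>w f i - w g i\<bar> \<le> 1 / M" if "i \<in> I" for i
      proof -
        have "\<lfloor>w f i * M\<rfloor> = \<lfloor>w g i * M\<rfloor>" using fun_cong[OF fg(3), of i] that by (simp add: G_def)
        then have "\<bar>w f i * M - w g i * M\<bar> \<le> 1" by linarith
        then have "\<bar>w f i - w g i\<bar> * M \<le> 1" using M0 by (simp add: abs_mult flip: left_diff_distrib)
        then show ?thesis using M0 by (simp add: field_simps)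
      qed
      have "f x - g x = (\<Sum>i\<in>I. (w f i - w g i) * b i x)"
        using fun_cong[OF fw[OF fg(1)], of x] fun_cong[OF fw[OF fg(2)], of x]
        by (simp add: left_diff_distrib sum_subtractf)
      then have "r \<le> (\<Sum>i\<in>I. \<bar>(w f i - w g i) * b i x\<bar>)" using x(2) by (metis order_trans sum_abs)
      also have "\<dots> \<le> (\<Sum>i\<in>I. 1 / M * \<bar>b i x\<bar>)"
        unfolding abs_mult using d by (intro sum_mono mult_right_mono) auto
      also have "\<dots> = (\<Sum>i\<in>I. \<bar>b i x\<bar>) / M" by (simp add: sum_divide_distrib)
      also have "\<dots> < B / M" using B[OF x(1)] M0 by (simp add: divide_strict_right_mono)
      also have "\<dots> \<le> r" using M(1) M0 r by (simp add: field_simps)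
      finally show False by simp
    qed
    have into: "G ` T \<subseteq> I \<rightarrow>\<^sub>E {-M..M}"
    proof -
      have "-M \<le> \<lfloor>w f i * M\<rfloor> \<and> \<lfloor>w f i * M\<rfloor> \<le> M" if "f \<in> T" "i \<in> I" for f i
      proof -
        have "\<bar>w f i * M\<bar> \<le> M" using w[OF that] M0 by (simp add: abs_mult mult_left_le_one_le)
        then show ?thesis by linarith
      qed
      then show ?thesis by (auto simp: G_def)
    qed
    have "card T = card (G ` T)" using inj by (simp add: card_image)
    also have "\<dots> \<le> card (I \<rightarrow>\<^sub>E {-M..M})" using into \<open>finite I\<close> by (intro card_mono finite_PiE) auto
    also have "\<dots> = card {-M..M} ^ card I" using \<open>finite I\<close> by (simp add: card_PiE)
    \<comment> \<open>Since \<open>r \<le> 1\<close>, additive constants are absorbed into the multiple of \<open>1 / r\<close>.\<close>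
    finally have "real (card T) \<le> real (card {-M..M}) ^ card I" by (metis of_nat_le_iff of_nat_power)
    also have "\<dots> \<le> ((2 * B + 3) / r) ^ card I"
    proof (rule power_mono)
      have "real (card {-M..M}) = 2 * M + 1" using M0 by simp
      also have "\<dots> \<le> 2 * (B / r) + 3 / r"
      proof -
        have "3 \<le> 3 / r" using r by (simp add: field_simps)
        then show ?thesis using M(2) by linarith
      qed
      also have "\<dots> = (2 * B + 3) / r" by (simp add: add_divide_distrib)
      finally show "real (card {-M..M}) \<le> (2 * B + 3) / r" .
    qed simp
    finally show ?thesis .
  qed
  define sepd where "sepd = (\<lambda>S. S \<subseteq> A \<and> finite S \<and> (\<forall>f\<in>S. \<forall>g\<in>S. f \<noteq> g \<longrightarrow> (\<exists>x\<in>X. \<delta> < \<bar>f x - g x\<bar>)))"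
  have card_le: "real (card S) \<le> (1 + 2 / \<delta>) ^ card I" if S: "sepd S" for S
  proof (rule separated_card_bound[where A = A and X = X and C = "2 * B + 3"])
    show "(\<lambda>x. (1 - l) * f x + l * g x) \<in> A" if "f \<in> A" "g \<in> A" "0 \<le> l" "l \<le> 1" for f g l
      by (rule conv[OF that])
    show "\<bar>f x\<bar> \<le> 1" if "f \<in> A" "x \<in> X" for f x using that by (auto simp: A_def)
    show "real (card T) \<le> ((2 * B + 3) / r) ^ card I"
      if "0 < r" "r \<le> 1" "T \<subseteq> A" "finite T"
        "\<And>f g. f \<in> T \<Longrightarrow> g \<in> T \<Longrightarrow> f \<noteq> g \<Longrightarrow> \<exists>x\<in>X. r \<le> \<bar>f x - g x\<bar>" for r T
      by (rule crude[OF that])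
    show "S \<subseteq> A" "finite S" using S by (auto simp: sepd_def)
    show "\<exists>x\<in>X. \<delta> < \<bar>f x - g x\<bar>" if "f \<in> S" "g \<in> S" "f \<noteq> g" for f g
      using S that by (auto simp: sepd_def)
  qed (rule \<open>\<delta> > 0\<close>)
  have zero: "(\<lambda>_. 0) \<in> A" by (auto simp: A_def intro!: exI[of _ "\<lambda>_. 0"])
  have "sepd {\<lambda>_. 0}" using zero by (simp add: sepd_def)
  moreover have "\<forall>S. sepd S \<longrightarrow> card S < Suc (nat \<lfloor>(1 + 2 / \<delta>) ^ card I\<rfloor>)"
    using card_le by (auto simp: less_Suc_eq_le le_nat_floor)
  ultimately obtain S where S: "sepd S" and max: "\<And>T. sepd T \<Longrightarrow> card T \<le> card S"
    using Lattices_Big.ex_has_greatest_nat[of sepd "{\<lambda>_. 0}" card] by blast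
  have "card {\<lambda>_::'a. 0::real} \<le> card S" using \<open>sepd {\<lambda>_. 0}\<close> by (rule max)
  then have "S \<noteq> {}" by auto
  have net: "\<exists>h\<in>S. \<forall>x\<in>X. \<bar>g x - h x\<bar> \<le> \<delta>" if g: "g \<in> A" for g
  proof (rule ccontr)
    assume "\<not> ?thesis"
    then have far: "\<And>h. h \<in> S \<Longrightarrow> \<exists>x\<in>X. \<delta> < \<bar>g x - h x\<bar>" by (meson not_le)
    then have "g \<notin> S" using \<open>\<delta> > 0\<close> by force
    moreover have "sepd (insert g S)"
      using S g far by (auto simp: sepd_def abs_minus_commute)
    ultimately show False using max[of "insert g S"] S by (simp add: sepd_def)
  qed
  show ?thesis
  proof (intro exI[of _ S] conjI ballI)
    show "S \<subseteq> A" "finite S" using S by (auto simp: sepd_def)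
  qed (fact \<open>S \<noteq> {}\<close>, fact card_le[OF S], fact net)
qed

section \<open>Monomials and generalized binomial coefficients\<close>

lemma gen_binomial_of_nat: "gen_binomial (real m) d = real ((m + d) choose d)"
proof (induction d)
  case (Suc d)
  have "real (Suc d) * real (Suc (m + d) choose Suc d) = real (Suc (m + d)) * real ((m + d) choose d)"
    by (metis Suc_times_binomial_eq mult.commute of_nat_mult)
  then have "real (Suc (m + d)) * gen_binomial (real m) d = real (Suc d) * real ((m + Suc d) choose Suc d)"
    using Suc by simp
  moreover have "real (Suc d) * gen_binomial (real m) (Suc d) = real (Suc (m + d)) * gen_binomial (real m) d"
  proof -
    define P where "P = (\<Prod>i=1..d. real m + real i)"
    have "gen_binomial (real m) d = P / fact d"
      and "gen_binomial (real m) (Suc d) = P * real (Suc (m + d)) / (real (Suc d) * fact d)"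
      by (simp_all add: gen_binomial_def P_def)
    then show ?thesis by simp
  qed
  ultimately have "real (Suc d) * gen_binomial (real m) (Suc d) = real (Suc d) * real ((m + Suc d) choose Suc d)"
    by simp
  then show ?case by (metis mult_cancel_left of_nat_eq_0_iff old.nat.distinct(2))
qed (simp add: gen_binomial_def)

lemma gen_binomial_mono:
  assumes "0 \<le> s" "s \<le> t"
  shows "gen_binomial s d \<le> gen_binomial t d"
  unfolding gen_binomial_def using assms by (intro mult_left_mono prod_mono) auto

lemma gen_binomial_scale_le:
  assumes "0 \<le> t" "1 \<le> c"
  shows "gen_binomial (c * t) d \<le> c ^ d * gen_binomial t d"
proof -
  have "(\<Prod>i=1..d. c * t + real i) \<le> (\<Prod>i=1..d. c * (t + real i))"
    using assms by (intro prod_mono) (auto simp: distrib_left mult_le_cancel_right1)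
  then show ?thesis by (simp add: gen_binomial_def prod.distrib divide_right_mono)
qed

lemma finite_multisets_below: "finite {M :: 'd::finite multiset. size M < n}"
proof -
  have "{M :: 'd multiset. size M < n} = (\<Union>m<n. multisets_of_size UNIV m)"
    by (auto simp: multisets_of_size_def)
  then show ?thesis by (simp only:) (intro finite_UN_I finite_multisets_of_size finite finite_lessThan)
qed

lemma card_multisets_below:
  "card {M :: 'd::finite multiset. size M < Suc n} = (n + CARD('d)) choose CARD('d)"
proof -
  have "{M :: 'd multiset. size M < Suc n} = (\<Union>m\<le>n. multisets_of_size UNIV m)"
    by (auto simp: multisets_of_size_def)
  then have "card {M :: 'd multiset. size M < Suc n} = (\<Sum>m\<le>n. card (multisets_of_size (UNIV :: 'd set) m))"
    by (simp only:) (intro card_UN_disjoint, auto intro!: finite_multisets_of_size dest!: multisets_of_size_size)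
  also have "\<dots> = (\<Sum>m\<le>n. ((CARD('d) - 1) + m) choose m)"
    by (intro sum.cong refl) (simp add: card_multisets_of_size Suc_leI)
  also have "\<dots> = Suc (CARD('d) - 1 + n) choose n" by (rule sum_choose_lower)
  also have "\<dots> = (n + CARD('d)) choose n" by (simp add: Suc_leI add.commute)
  finally show ?thesis by (simp add: binomial_symmetric[of n])
qed

section \<open>Interpolation by kernel sections\<close>

definition quad_form :: "'a set \<Rightarrow> ('a \<Rightarrow> 'a \<Rightarrow> real) \<Rightarrow> ('a \<Rightarrow> real) \<Rightarrow> real"
  where "quad_form F k c = (\<Sum>x\<in>F. \<Sum>y\<in>F. c x * c y * k x y)"

text \<open>
  The form of \<open>u * c\<close> plus \<open>t\<close> times the unit vector at \<open>x\<close> is nonnegative for all \<open>u\<close> and \<open>t\<close>; the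
  inequality bounds the discriminant of this binary quadratic form.
\<close>

lemma quad_form_Cauchy_Schwarz:
  assumes F: "finite F" "x \<in> F" and sym: "\<And>a b. k a b = k b a"
    and psd: "\<And>c. 0 \<le> quad_form F k c"
  shows "(\<Sum>y\<in>F. c y * k y x)\<^sup>2 \<le> quad_form F k c * k x x"
proof -
  define r where "r = (\<Sum>y\<in>F. c y * k y x)"
  have expand: "quad_form F k (\<lambda>y. u * c y + (if y = x then t else 0)) = u\<^sup>2 * quad_form F k c + 2 * u * t * r + t\<^sup>2 * k x x"
    for u t
  proof -
    define R where "R = (\<lambda>a. \<Sum>b\<in>F. c b * k a b)"
    have row: "(\<Sum>b\<in>F. (u * c b + (if b = x then t else 0)) * k a b) = u * R a + t * k a x" for a
    proof -
      have "(\<Sum>b\<in>F. (u * c b + (if b = x then t else 0)) * k a b)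
          = (\<Sum>b\<in>F. u * (c b * k a b) + (if b = x then t * k a b else 0))"
        by (intro sum.cong) (auto simp: algebra_simps)
      then show ?thesis using F by (simp add: R_def sum.distrib sum_distrib_left)
    qed
    have "quad_form F k (\<lambda>y. u * c y + (if y = x then t else 0))
        = (\<Sum>a\<in>F. (u * c a + (if a = x then t else 0)) * (u * R a + t * k a x))"
      unfolding row[symmetric] by (simp add: quad_form_def sum_distrib_left mult.assoc)
    also have "\<dots> = (\<Sum>a\<in>F. u\<^sup>2 * (c a * R a) + u * t * (c a * k a x)
        + (if a = x then t * (u * R a + t * k a x) else 0))"
      by (intro sum.cong) (auto simp: algebra_simps power2_eq_square)
    also have "\<dots> = u\<^sup>2 * (\<Sum>a\<in>F. c a * R a) + u * t * r + t * (u * R x + t * k x x)"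
      using F by (simp add: sum.distrib r_def flip: sum_distrib_left)
    also have "(\<Sum>a\<in>F. c a * R a) = quad_form F k c"
      by (simp add: quad_form_def R_def sum_distrib_left mult.assoc)
    also have "R x = r" unfolding r_def R_def by (metis sym)
    finally show ?thesis by (simp add: algebra_simps power2_eq_square)
  qed
  have nonneg: "0 \<le> u\<^sup>2 * quad_form F k c + 2 * u * t * r + t\<^sup>2 * k x x" for u t
    using psd[of "\<lambda>y. u * c y + (if y = x then t else 0)"] by (simp add: expand)
  have "0 \<le> k x x" using nonneg[of 0 1] by simp
  show ?thesis
  proof (cases "k x x = 0")
    case True
    have "r = 0"
    proof (rule ccontr)
      assume "r \<noteq> 0"
      then show False using nonneg[of 1 "- (quad_form F k c + 1) / (2 * r)"] True by (simp add: field_simps)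
    qed
    then show ?thesis using True by (simp add: r_def)
  next
    case False
    with \<open>0 \<le> k x x\<close> have "0 < k x x" by simp
    moreover have "0 \<le> k x x * (k x x * quad_form F k c - r\<^sup>2)"
      using nonneg[of "k x x" "- r"] by (simp add: algebra_simps power2_eq_square)
    ultimately show ?thesis by (simp add: zero_le_mult_iff r_def mult.commute)
  qed
qed

lemma sum_fun_apply: "sum f F x = (\<Sum>i\<in>F. f i x)"
  for f :: "'i \<Rightarrow> 'a \<Rightarrow> 'b::comm_monoid_add"
  by (induction F rule: infinite_finite_induct) auto

context rkhs
begin

definition kernel_section :: "'a \<Rightarrow> 'a \<Rightarrow> real"
  where "kernel_section x = (\<lambda>y. if y \<in> X then k x y else 0)"

lemma ip_zero_left: "f \<in> H \<Longrightarrow> ip 0 f = 0"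
  using ip_scaleR_left[of f f 0] by simp

lemma ip_nonneg: "f \<in> H \<Longrightarrow> 0 \<le> ip f f"
  using ip_pos[of f] ip_zero_left[of f] by (cases "f = 0") auto

lemma kernel_sum_mem_and_ip:
  assumes "finite F" "F \<subseteq> X"
  shows "(\<Sum>z\<in>F. c z *\<^sub>R kernel_section z) \<in> H"
    and "f \<in> H \<Longrightarrow> ip f (\<Sum>z\<in>F. c z *\<^sub>R kernel_section z) = (\<Sum>z\<in>F. c z * f z)"
proof -
  have mem: "kernel_section z \<in> H" if "z \<in> X" for z using kernel_mem[OF that] by (simp add: kernel_section_def)
  have memsum: "(\<Sum>z\<in>G. c z *\<^sub>R kernel_section z) \<in> H" if "G \<subseteq> X" for G
    using that mem by (intro subspace_sum[OF subspace] subspace_scale[OF subspace]) auto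
  then show "(\<Sum>z\<in>F. c z *\<^sub>R kernel_section z) \<in> H" using assms by blast
  assume f: "f \<in> H"
  show "ip f (\<Sum>z\<in>F. c z *\<^sub>R kernel_section z) = (\<Sum>z\<in>F. c z * f z)"
    using assms
  proof (induction F rule: finite_induct)
    case empty
    show ?case using ip_zero_left[OF f] ip_commute[OF f] subspace_0[OF subspace] by (simp add: zero_fun_def)
  next
    case (insert y F)
    then have y: "y \<in> X" and F: "F \<subseteq> X" by auto
    note my = mem[OF y] and mF = memsum[OF F]
    have msy: "c y *\<^sub>R kernel_section y \<in> H" using my subspace_scale[OF subspace] by blast
    have "ip f (\<Sum>z\<in>insert y F. c z *\<^sub>R kernel_section z)
        = ip (c y *\<^sub>R kernel_section y + (\<Sum>z\<in>F. c z *\<^sub>R kernel_section z)) f"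
      using insert.hyps ip_commute[OF f] memsum[OF insert.prems] by simp
    also have "\<dots> = c y * ip (kernel_section y) f + ip (\<Sum>z\<in>F. c z *\<^sub>R kernel_section z) f"
      using ip_add_left[OF msy mF f] ip_scaleR_left[OF my f] by simp
    also have "\<dots> = c y * ip f (kernel_section y) + ip f (\<Sum>z\<in>F. c z *\<^sub>R kernel_section z)"
      using ip_commute[OF f] my mF by simp
    also have "ip f (kernel_section y) = f y" using reproducing[OF f y] by (simp add: kernel_section_def)
    finally show ?case using insert F by simp
  qed
qed

lemma kernel_sum_apply:
  assumes "F \<subseteq> X" "x \<in> X"
  shows "(\<Sum>z\<in>F. c z *\<^sub>R kernel_section z) x = (\<Sum>z\<in>F. c z * k z x)"
  using assms by (simp add: sum_fun_apply scaleR_fun_def kernel_section_def)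

text \<open>
  Gram--Schmidt: the new section at \<open>y\<close> minus its interpolant \<open>v\<close> on \<open>F\<close> vanishes on \<open>F\<close>. If it does not
  vanish at \<open>y\<close>, a multiple of it corrects the value there. If it does, it is orthogonal to
  itself and hence zero; then evaluation at \<open>y\<close> is on all of \<open>H\<close> a combination of the
  evaluations on \<open>F\<close>, and the old coefficients already interpolate at \<open>y\<close>.
\<close>

lemma kernel_interpolation:
  assumes "finite F" "F \<subseteq> X" "f \<in> H"
  shows "\<exists>c. \<forall>x\<in>F. f x = (\<Sum>z\<in>F. c z * k z x)"
  using assms
proof (induction F arbitrary: f rule: finite_induct)
  case (insert y F)
  then have y: "y \<in> X" and F: "F \<subseteq> X" by auto
  have ky: "kernel_section y \<in> H" using kernel_mem[OF y] by (simp add: kernel_section_def)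
  obtain c where c: "\<And>x. x \<in> F \<Longrightarrow> f x = (\<Sum>z\<in>F. c z * k z x)" using insert.IH[OF F insert.prems(2)] by blast
  obtain e where "\<And>x. x \<in> F \<Longrightarrow> kernel_section y x = (\<Sum>z\<in>F. e z * k z x)" using insert.IH[OF F ky] by blast
  then have e: "\<And>x. x \<in> F \<Longrightarrow> k y x = (\<Sum>z\<in>F. e z * k z x)" using F by (force simp: kernel_section_def)
  define v where "v = (\<Sum>z\<in>F. e z *\<^sub>R kernel_section z)"
  define u where "u = kernel_section y - v"
  have vH: "v \<in> H" unfolding v_def by (rule kernel_sum_mem_and_ip(1)[OF insert.hyps(1) F])
  have uH: "u \<in> H" unfolding u_def by (rule subspace_diff[OF subspace ky vH])
  have u_at: "u x = k y x - (\<Sum>z\<in>F. e z * k z x)" if "x \<in> X" for x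
    using that kernel_sum_apply[OF F that, of e] by (simp add: u_def v_def kernel_section_def)
  define h where "h = (\<Sum>z\<in>F. c z * k z y)"
  show ?case
  proof (cases "u y = 0")
    case False
    define t where "t = (f y - h) / u y"
    define c' where "c' = (\<lambda>z. if z = y then t else c z - t * e z)"
    have sum': "(\<Sum>z\<in>insert y F. c' z * k z x) = (\<Sum>z\<in>F. c z * k z x) + t * u x" if "x \<in> X" for x
    proof -
      have "(\<Sum>z\<in>insert y F. c' z * k z x) = t * k y x + (\<Sum>z\<in>F. (c z - t * e z) * k z x)"
        using insert.hyps by (auto simp: c'_def intro!: sum.cong)
      then show ?thesis using that
        by (simp add: u_at sum_subtractf left_diff_distrib right_diff_distrib sum_distrib_left mult.assoc)
    qed
    have "f x = (\<Sum>z\<in>insert y F. c' z * k z x)" if "x \<in> insert y F" for x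
    proof (cases "x = y")
      case True
      then show ?thesis using sum'[OF y] False by (simp add: t_def h_def)
    next
      case False
      then have x: "x \<in> F" "x \<in> X" using that F by auto
      then show ?thesis using sum'[OF x(2)] u_at[OF x(2)] c[OF x(1)] e[OF x(1)] by simp
    qed
    then show ?thesis by blast
  next
    case True
    have split: "ip g u = g y - (\<Sum>z\<in>F. e z * g z)" if g: "g \<in> H" for g
    proof -
      have "ip g u = ip (kernel_section y + (-1) *\<^sub>R v) g"
        using ip_commute[OF g uH] by (simp add: u_def)
      also have "\<dots> = ip (kernel_section y) g - ip v g"
        using ip_add_left[OF ky subspace_scale[OF subspace vH] g, of "-1"] ip_scaleR_left[OF vH g, of "-1"] by simp
      also have "\<dots> = ip g (kernel_section y) - ip g v" using ip_commute[OF g] ky vH by simp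
      also have "ip g (kernel_section y) = g y" using reproducing[OF g y] by (simp add: kernel_section_def)
      also have "ip g v = (\<Sum>z\<in>F. e z * g z)"
        unfolding v_def by (rule kernel_sum_mem_and_ip(2)[OF insert.hyps(1) F g])
      finally show ?thesis .
    qed
    have "u z = 0" if "z \<in> F" for z using u_at[of z] e[OF that] F that by auto
    then have "ip u u = 0" using split[OF uH] True by simp
    then have u0: "u = 0" using ip_pos[OF uH] by force
    have vanish: "g y = (\<Sum>z\<in>F. e z * g z)" if g: "g \<in> H" for g
      using split[OF g] ip_zero_left[OF g] ip_commute[OF g uH] u0 by simp
    define c' where "c' = (\<lambda>z. if z = y then 0 else c z)"
    have sum': "(\<Sum>z\<in>insert y F. c' z * k z x) = (\<Sum>z\<in>F. c z * k z x)" for x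
      using insert.hyps by (auto simp: c'_def intro!: sum.cong)
    define s where "s = (\<Sum>z\<in>F. c z *\<^sub>R kernel_section z)"
    have sH: "s \<in> H" unfolding s_def by (rule kernel_sum_mem_and_ip(1)[OF insert.hyps(1) F])
    have s_at: "s x = (\<Sum>z\<in>F. c z * k z x)" if "x \<in> X" for x
      unfolding s_def by (rule kernel_sum_apply[OF F that])
    have "f y = (\<Sum>z\<in>F. e z * f z)" by (rule vanish[OF insert.prems(2)])
    also have "\<dots> = (\<Sum>z\<in>F. e z * s z)" using c s_at F by (intro sum.cong) auto
    also have "\<dots> = s y" by (rule vanish[OF sH, symmetric])
    finally have "f y = (\<Sum>z\<in>F. c z * k z y)" using s_at[OF y] by simp
    then show ?thesis using c sum' by (intro exI[of _ c']) auto
  qed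
qed simp

text \<open>
  The interpolant \<open>h\<close> is the orthogonal projection of \<open>f\<close> to the span of the sections over \<open>F\<close>, so
  its norm, whose square is the quadratic form of the coefficients, is at most that of \<open>f\<close>.
\<close>

lemma unit_ball_on_finite:
  assumes F: "finite F" "F \<subseteq> X" and f: "f \<in> unit_ball H (ip_norm ip)"
  shows "\<exists>c. (\<forall>x\<in>F. f x = (\<Sum>z\<in>F. c z * k z x)) \<and> quad_form F k c \<le> 1"
proof -
  have fH: "f \<in> H" and "ip f f \<le> 1" using f by (auto simp: unit_ball_def ip_norm_def)
  obtain c where c: "\<And>x. x \<in> F \<Longrightarrow> f x = (\<Sum>z\<in>F. c z * k z x)" using kernel_interpolation[OF F fH] by blast
  define h where "h = (\<Sum>z\<in>F. c z *\<^sub>R kernel_section z)"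
  have hH: "h \<in> H" unfolding h_def by (rule kernel_sum_mem_and_ip(1)[OF F])
  have h_at: "h x = f x" if "x \<in> F" for x
    using kernel_sum_apply[OF F(2), of x c] c[OF that] F that by (auto simp: h_def)
  have ih: "ip g h = (\<Sum>z\<in>F. c z * g z)" if "g \<in> H" for g
    unfolding h_def by (rule kernel_sum_mem_and_ip(2)[OF F that])
  have same: "ip f h = ip h h" using ih[OF fH] ih[OF hH] h_at by simp
  have mh: "(-1) *\<^sub>R h \<in> H" by (rule subspace_scale[OF subspace hH])
  define g where "g = f + (-1) *\<^sub>R h"
  have gH: "g \<in> H" unfolding g_def by (rule subspace_add[OF subspace fH mh])
  have ipg: "ip g a = ip f a - ip h a" if a: "a \<in> H" for a
    unfolding g_def using ip_add_left[OF fH mh a] ip_scaleR_left[OF hH a, of "-1"] by simp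
  have "0 \<le> ip g g" by (rule ip_nonneg[OF gH])
  also have "ip g g = ip f g - ip h g" by (rule ipg[OF gH])
  also have "\<dots> = ip g f - ip g h" using ip_commute[OF fH gH] ip_commute[OF hH gH] by simp
  also have "\<dots> = ip f f - ip h h" using ipg[OF fH] ipg[OF hH] same ip_commute[OF fH hH] by simp
  finally have "ip h h \<le> 1" using \<open>ip f f \<le> 1\<close> by simp
  moreover have "ip h h = quad_form F k c"
  proof -
    have "ip h h = (\<Sum>x\<in>F. c x * f x)" using ih[OF fH] same by simp
    also have "\<dots> = (\<Sum>x\<in>F. \<Sum>z\<in>F. c x * c z * k z x)"
      using c by (intro sum.cong) (auto simp: sum_distrib_left mult.assoc)
    also have "\<dots> = quad_form F k c"
      unfolding quad_form_def by (subst sum.swap) (simp add: mult.commute mult.left_commute)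
    finally show ?thesis .
  qed
  ultimately show ?thesis using c by auto
qed

end


section \<open>Splitting the Gaussian kernel by degree\<close>

definition monomial_at :: "'d multiset \<Rightarrow> real ^ 'd::finite \<Rightarrow> real"
  where "monomial_at M x = (\<Prod>i\<in>#M. x $ i)"

text \<open>
  The multinomial coefficient of the monomial \<open>M\<close>.
\<close>

definition orderings :: "'d multiset \<Rightarrow> nat"
  where "orderings M = card {s. mset s = M}"

lemma inner_power_words:
  fixes x y :: "real ^ 'd::finite"
  shows "(x \<bullet> y) ^ m = (\<Sum>s | length s = m. monomial_at (mset s) x * monomial_at (mset s) y)"
proof (induction m)
  case 0
  show ?case by (simp add: monomial_at_def)
next
  case (Suc m)
  let ?c = "\<lambda>(i, s). i # s :: 'd list"
  have words: "{s :: 'd list. length s = Suc m} = ?c ` (UNIV \<times> {s. length s = m})"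
    by (auto simp: length_Suc_conv image_iff)
  have inj: "inj_on ?c (UNIV \<times> {s. length s = m})" by (auto simp: inj_on_def)
  have "(\<Sum>s :: 'd list | length s = Suc m. monomial_at (mset s) x * monomial_at (mset s) y)
      = (\<Sum>(i, s)\<in>UNIV \<times> {s. length s = m}. (x $ i * y $ i) * (monomial_at (mset s) x * monomial_at (mset s) y))"
    unfolding words by (subst sum.reindex[OF inj]) (auto simp: monomial_at_def mult_ac intro!: sum.cong)
  also have "\<dots> = (\<Sum>i\<in>UNIV. x $ i * y $ i) * (\<Sum>s | length s = m. monomial_at (mset s) x * monomial_at (mset s) y)"
    by (simp add: sum_product sum.cartesian_product)
  finally show ?case using Suc by (simp add: inner_vec_def)
qed

text \<open>
  The multinomial theorem, read off from the expansion into words by collecting the words with the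
  same letters.
\<close>

lemma inner_power_multisets:
  fixes x y :: "real ^ 'd::finite"
  shows "(x \<bullet> y) ^ m = (\<Sum>M | size M = m. orderings M * (monomial_at M x * monomial_at M y))"
proof -
  have fin: "finite {s :: 'd list. length s = m}"
    using finite_lists_length_eq[of "UNIV :: 'd set" m] by simp
  have img: "mset ` {s :: 'd list. length s = m} = {M. size M = m}"
    by (auto simp: image_iff) (metis ex_mset size_mset)
  have "(x \<bullet> y) ^ m = (\<Sum>M\<in>mset ` {s :: 'd list. length s = m}.
      \<Sum>s | s \<in> {s. length s = m} \<and> mset s = M. monomial_at (mset s) x * monomial_at (mset s) y)"
    unfolding inner_power_words by (rule sum.image_gen[OF fin])
  also have "\<dots> = (\<Sum>M | size M = m. orderings M * (monomial_at M x * monomial_at M y))"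
    unfolding img
  proof (intro sum.cong refl)
    fix M :: "'d multiset" assume "M \<in> {M. size M = m}"
    then have "{s. s \<in> {s. length s = m} \<and> mset s = M} = {s. mset s = M}" by auto
    then show "(\<Sum>s | s \<in> {s. length s = m} \<and> mset s = M. monomial_at (mset s) x * monomial_at (mset s) y)
        = orderings M * (monomial_at M x * monomial_at M y)" by (simp add: orderings_def)
  qed
  finally show ?thesis .
qed

lemma orderings_pos: "1 \<le> orderings (M :: 'd::finite multiset)"
proof -
  obtain s where "mset s = M" using ex_mset by blast
  moreover have "finite {s :: 'd list. mset s = M}"
    by (rule finite_subset[OF _ finite_lists_length_eq[of "UNIV :: 'd set" "size M"]]) auto
  ultimately show ?thesis unfolding orderings_def by (metis (mono_tags, lifting) One_nat_def Suc_leI card_gt_0_iff empty_iff mem_Collect_eq)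
qed

text \<open>
  Each monomial is scaled such that the Gaussian kernel is the sum over all \<open>M\<close> of
  \<open>orderings M * (feature \<sigma> M x * feature \<sigma> M y)\<close>.
\<close>

definition feature :: "real \<Rightarrow> 'd::finite multiset \<Rightarrow> real ^ 'd \<Rightarrow> real"
  where "feature \<sigma> M x = sqrt ((2 * \<sigma>\<^sup>2) ^ size M / fact (size M)) * exp (- \<sigma>\<^sup>2 * (norm x)\<^sup>2) * monomial_at M x"

definition layer :: "real \<Rightarrow> nat \<Rightarrow> real ^ 'd::finite \<Rightarrow> real ^ 'd \<Rightarrow> real"
  where "layer \<sigma> m x y = (\<Sum>M | size M = m. orderings M * (feature \<sigma> M x * feature \<sigma> M y))"

lemma layer_eq:
  "layer \<sigma> m x y = exp (- \<sigma>\<^sup>2 * (norm x)\<^sup>2) * exp (- \<sigma>\<^sup>2 * (norm y)\<^sup>2) * ((2 * \<sigma>\<^sup>2 * (x \<bullet> y)) ^ m / fact m)"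
proof -
  have "feature \<sigma> M x * feature \<sigma> M y = exp (- \<sigma>\<^sup>2 * (norm x)\<^sup>2) * exp (- \<sigma>\<^sup>2 * (norm y)\<^sup>2)
      * ((2 * \<sigma>\<^sup>2) ^ m / fact m) * (monomial_at M x * monomial_at M y)" if "size M = m" for M
  proof -
    define q where "q = sqrt ((2 * \<sigma>\<^sup>2) ^ m / fact m)"
    have "q * q = (2 * \<sigma>\<^sup>2) ^ m / fact m" by (simp add: q_def)
    then show ?thesis using that unfolding feature_def by (simp add: mult_ac flip: q_def)
  qed
  then have "layer \<sigma> m x y = exp (- \<sigma>\<^sup>2 * (norm x)\<^sup>2) * exp (- \<sigma>\<^sup>2 * (norm y)\<^sup>2) * ((2 * \<sigma>\<^sup>2) ^ m / fact m)
      * (\<Sum>M | size M = m. orderings M * (monomial_at M x * monomial_at M y))"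
    unfolding layer_def sum_distrib_left by (intro sum.cong) (auto simp: mult_ac)
  then show ?thesis by (simp add: power_mult_distrib flip: inner_power_multisets)
qed

lemma layer_sums: "(\<lambda>m. layer \<sigma> m x y) sums gaussian_kernel \<sigma> x y"
  for x y :: "real ^ 'd::finite"
proof -
  have "- \<sigma>\<^sup>2 * (norm (x - y))\<^sup>2 = (- \<sigma>\<^sup>2 * (norm x)\<^sup>2 + - \<sigma>\<^sup>2 * (norm y)\<^sup>2) + 2 * \<sigma>\<^sup>2 * (x \<bullet> y)"
    by (simp add: power2_norm_eq_inner inner_diff inner_commute algebra_simps)
  then have "gaussian_kernel \<sigma> x y = exp (- \<sigma>\<^sup>2 * (norm x)\<^sup>2) * exp (- \<sigma>\<^sup>2 * (norm y)\<^sup>2) * exp (2 * \<sigma>\<^sup>2 * (x \<bullet> y))"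
    by (simp only: gaussian_kernel_def exp_add)
  moreover have "(\<lambda>m. (2 * \<sigma>\<^sup>2 * (x \<bullet> y)) ^ m / fact m) sums exp (2 * \<sigma>\<^sup>2 * (x \<bullet> y))"
    using exp_converges[of "2 * \<sigma>\<^sup>2 * (x \<bullet> y)"] by (simp add: divide_inverse mult.commute)
  ultimately show ?thesis unfolding layer_eq by (simp only: sums_mult)
qed

definition low_kernel :: "real \<Rightarrow> nat \<Rightarrow> real ^ 'd::finite \<Rightarrow> real ^ 'd \<Rightarrow> real"
  where "low_kernel \<sigma> n x y = (\<Sum>m<n. layer \<sigma> m x y)"

lemma low_kernel_eq_features:
  fixes x y :: "real ^ 'd::finite"
  shows "low_kernel \<sigma> n x y = (\<Sum>M | size M < n. orderings M * (feature \<sigma> M x * feature \<sigma> M y))"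
proof -
  have fin: "finite {M :: 'd multiset. size M = m}" for m
    by (rule finite_subset[of _ "{M :: 'd multiset. size M < Suc m}"]) (auto simp: finite_multisets_below)
  have "{M :: 'd multiset. size M < n} = (\<Union>m<n. {M. size M = m})" by auto
  then show ?thesis unfolding low_kernel_def layer_def
    by (simp only:) (rule sum.UNION_disjoint[symmetric], auto simp: fin)
qed

lemma quad_form_features:
  assumes "finite F"
  shows "quad_form F (\<lambda>x y. \<Sum>i\<in>I. v i * (g i x * g i y)) c = (\<Sum>i\<in>I. v i * (\<Sum>x\<in>F. c x * g i x)\<^sup>2)"
proof -
  have "(\<Sum>i\<in>I. v i * (\<Sum>x\<in>F. c x * g i x)\<^sup>2) = (\<Sum>i\<in>I. \<Sum>x\<in>F. \<Sum>y\<in>F. c x * c y * (v i * (g i x * g i y)))"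
    by (simp add: power2_eq_square sum_product sum_distrib_left mult_ac)
  also have "\<dots> = (\<Sum>x\<in>F. \<Sum>y\<in>F. \<Sum>i\<in>I. c x * c y * (v i * (g i x * g i y)))"
    by (subst sum.swap) (intro sum.cong refl sum.swap)
  finally show ?thesis by (simp add: quad_form_def sum_distrib_left)
qed

lemma quad_form_layer_nonneg: "finite F \<Longrightarrow> 0 \<le> quad_form F (layer \<sigma> m) c"
  unfolding layer_def[abs_def] by (subst quad_form_features) (auto intro!: sum_nonneg)

lemma quad_form_low_kernel: "quad_form F (low_kernel \<sigma> n) c = (\<Sum>m<n. quad_form F (layer \<sigma> m) c)"
proof -
  have "(\<Sum>m<n. quad_form F (layer \<sigma> m) c) = (\<Sum>x\<in>F. \<Sum>m<n. \<Sum>y\<in>F. c x * c y * layer \<sigma> m x y)"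
    unfolding quad_form_def by (rule sum.swap)
  also have "\<dots> = (\<Sum>x\<in>F. \<Sum>y\<in>F. \<Sum>m<n. c x * c y * layer \<sigma> m x y)"
    by (intro sum.cong refl sum.swap)
  finally show ?thesis by (simp add: quad_form_def low_kernel_def sum_distrib_left)
qed

text \<open>
  The omitted layers contribute nonnegative quadratic forms.
\<close>

lemma quad_form_low_kernel_le:
  assumes "finite F"
  shows "quad_form F (low_kernel \<sigma> n) c \<le> quad_form F (gaussian_kernel \<sigma>) c"
proof -
  have "(\<lambda>m. quad_form F (layer \<sigma> m) c) sums quad_form F (gaussian_kernel \<sigma>) c"
    unfolding quad_form_def by (intro sums_sum sums_mult layer_sums)
  then show ?thesis unfolding quad_form_low_kernel
    using sum_le_suminf[of "\<lambda>m. quad_form F (layer \<sigma> m) c" "{..<n}"] quad_form_layer_nonneg[OF assms]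
    by (auto simp: sums_iff)
qed

lemma quad_form_low_kernel_nonneg: "finite F \<Longrightarrow> 0 \<le> quad_form F (low_kernel \<sigma> n) c"
  unfolding quad_form_low_kernel by (simp add: sum_nonneg quad_form_layer_nonneg)

text \<open>
  On the diagonal the difference is \<open>exp (- s)\<close> times the Taylor remainder of \<open>exp\<close> at
  \<open>s = 2 * \<sigma>\<^sup>2 * (x \<bullet> x)\<close>; the factor \<open>exp (- s)\<close> absorbs the exponential in its Lagrange form.
\<close>

lemma gaussian_minus_low_kernel_diagonal:
  assumes "norm x \<le> 1"
  shows "gaussian_kernel \<sigma> x x - low_kernel \<sigma> n x x \<le> (2 * \<sigma>\<^sup>2) ^ n / fact n"
proof -
  define s where "s = 2 * \<sigma>\<^sup>2 * (x \<bullet> x)"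
  have s: "0 \<le> s" "s \<le> 2 * \<sigma>\<^sup>2"
    using assms by (auto simp: s_def mult_left_le power_le_one simp flip: power2_norm_eq_inner)
  have E: "exp (- \<sigma>\<^sup>2 * (norm x)\<^sup>2) * exp (- \<sigma>\<^sup>2 * (norm x)\<^sup>2) = exp (- s)"
    by (simp add: s_def power2_norm_eq_inner flip: exp_add)
  have low: "low_kernel \<sigma> n x x = exp (- s) * (\<Sum>m<n. s ^ m / fact m)"
    unfolding low_kernel_def layer_eq E by (simp add: sum_distrib_left s_def)
  obtain t where t: "\<bar>t\<bar> \<le> \<bar>s\<bar>" "exp s = (\<Sum>m<n. s ^ m / fact m) + (exp t / fact n) * s ^ n"
    using Maclaurin_exp_le by blast
  have "gaussian_kernel \<sigma> x x - low_kernel \<sigma> n x x = exp (- s) * (exp s - (\<Sum>m<n. s ^ m / fact m))"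
    unfolding low by (simp add: gaussian_kernel_def right_diff_distrib flip: exp_add)
  also have "\<dots> = exp (t - s) * (s ^ n / fact n)"
    unfolding t(2) by (simp add: exp_diff exp_minus field_simps)
  also have "\<dots> \<le> 1 * (s ^ n / fact n)" using t s by (intro mult_right_mono) auto
  also have "\<dots> \<le> (2 * \<sigma>\<^sup>2) ^ n / fact n" using power_mono[OF s(2,1), of n] by (simp add: divide_right_mono)
  finally show ?thesis .
qed

lemma low_kernel_commute: "low_kernel \<sigma> n x y = low_kernel \<sigma> n y x"
  unfolding low_kernel_def layer_def by (simp add: mult_ac)

lemma gaussian_kernel_commute: "gaussian_kernel \<sigma> x y = gaussian_kernel \<sigma> y x"
  by (simp add: gaussian_kernel_def norm_minus_commute)

text \<open>
  The low-degree part of the combination \<open>f\<close> is \<open>\<Sum>z\<in>F. c z * low_kernel \<sigma> n z x\<close>, and the rest is the same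
  sum for the difference \<open>h\<close> of the two kernels. Both kernels are positive semidefinite and their
  quadratic forms at \<open>c\<close> add up to at most 1, so Cauchy--Schwarz bounds the values at \<open>x\<close> by
  the square roots of the two diagonals. The quadratic form of the low kernel also bounds the coefficients
  \<open>w\<close>, being a sum of their squares with weights at least 1.
\<close>

lemma finite_feature_approximation:
  fixes F :: "(real ^ 'd::finite) set"
  assumes F: "finite F" "F \<subseteq> cball 0 1" and c: "quad_form F (gaussian_kernel \<sigma>) c \<le> 1"
    and tail: "(2 * \<sigma>\<^sup>2) ^ n / fact n \<le> \<delta>\<^sup>2" "0 \<le> \<delta>"
    and f: "\<And>x. x \<in> F \<Longrightarrow> f x = (\<Sum>z\<in>F. c z * gaussian_kernel \<sigma> z x)"
  defines "w \<equiv> \<lambda>M. \<Sum>z\<in>F. c z * feature \<sigma> M z"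
  shows "size M < n \<Longrightarrow> \<bar>w M\<bar> \<le> 1"
    and "x \<in> F \<Longrightarrow> \<bar>f x - (\<Sum>M | size M < n. w M * (orderings M * feature \<sigma> M x))\<bar> \<le> \<delta>"
    and "x \<in> F \<Longrightarrow> \<bar>\<Sum>M | size M < n. w M * (orderings M * feature \<sigma> M x)\<bar> \<le> 1"
proof -
  let ?k = "gaussian_kernel \<sigma> :: real ^ 'd \<Rightarrow> real ^ 'd \<Rightarrow> real" and ?l = "low_kernel \<sigma> n"
  define h where "h = (\<lambda>x y. ?k x y - ?l x y)"
  have finI: "finite {M :: 'd multiset. size M < n}" by (rule finite_multisets_below)
  have low_le: "quad_form F ?l c \<le> 1" using quad_form_low_kernel_le[OF F(1)] c by (rule order_trans)
  have h_quad: "quad_form F h c' = quad_form F ?k c' - quad_form F ?l c'" for c'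
    by (simp add: h_def quad_form_def right_diff_distrib sum_subtractf)
  have h_psd: "0 \<le> quad_form F h c'" for c' using quad_form_low_kernel_le[OF F(1)] by (simp add: h_quad)
  have h_le: "quad_form F h c \<le> 1" 
    using c quad_form_low_kernel_nonneg[OF F(1), of \<sigma> n c] by (simp add: h_quad)
  have g: "(\<Sum>M | size M < n. w M * (orderings M * feature \<sigma> M x)) = (\<Sum>z\<in>F. c z * ?l z x)" for x
    unfolding w_def low_kernel_eq_features sum_distrib_left sum_distrib_right
    by (subst sum.swap) (simp add: mult_ac)
  have quad_l: "quad_form F ?l c = (\<Sum>M | size M < n. orderings M * (w M)\<^sup>2)"
    unfolding w_def low_kernel_eq_features[abs_def] by (rule quad_form_features[OF F(1)])
  { assume M: "size M < n"
    have "(w M)\<^sup>2 \<le> orderings M * (w M)\<^sup>2"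
      using orderings_pos[of M] by (simp add: mult_le_cancel_right1)
    also have "\<dots> \<le> (\<Sum>M | size M < n. orderings M * (w M)\<^sup>2)"
      using finI M by (intro member_le_sum) auto
    finally have "(w M)\<^sup>2 \<le> 1" using low_le quad_l by simp
    then show "\<bar>w M\<bar> \<le> 1" by (simp add: abs_square_le_1) }
  { assume x: "x \<in> F"
    then have nx: "norm x \<le> 1" using F by auto
    have "(\<Sum>z\<in>F. c z * h z x)\<^sup>2 \<le> quad_form F h c * h x x"
      using h_psd by (intro quad_form_Cauchy_Schwarz F x)
        (simp_all add: h_def gaussian_kernel_commute low_kernel_commute)
    also have "\<dots> \<le> 1 * \<delta>\<^sup>2"
    proof (rule mult_mono)
      show "h x x \<le> \<delta>\<^sup>2" using gaussian_minus_low_kernel_diagonal[OF nx, of \<sigma> n] tail by (simp add: h_def)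
      show "0 \<le> h x x" using quad_form_low_kernel_le[of "{x}" \<sigma> n "\<lambda>_. 1"] by (simp add: h_def quad_form_def)
    qed (use h_le in auto)
    finally have "\<bar>\<Sum>z\<in>F. c z * h z x\<bar> \<le> \<delta>" 
      using tail(2) abs_le_square_iff[of "\<Sum>z\<in>F. c z * h z x" \<delta>] by simp
    moreover have "f x - (\<Sum>M | size M < n. w M * (orderings M * feature \<sigma> M x)) = (\<Sum>z\<in>F. c z * h z x)"
      unfolding g f[OF x] h_def by (simp add: right_diff_distrib sum_subtractf)
    ultimately show "\<bar>f x - (\<Sum>M | size M < n. w M * (orderings M * feature \<sigma> M x))\<bar> \<le> \<delta>" by simp
    have "(\<Sum>z\<in>F. c z * ?l z x)\<^sup>2 \<le> quad_form F ?l c * ?l x x"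
      using quad_form_low_kernel_nonneg[OF F(1)] by (intro quad_form_Cauchy_Schwarz F x low_kernel_commute)
    also have "\<dots> \<le> 1 * 1"
    proof (rule mult_mono[OF low_le])
      have "?l x x \<le> ?k x x"
        using quad_form_low_kernel_le[of "{x}" \<sigma> n "\<lambda>_. 1"] by (simp add: quad_form_def)
      then show "?l x x \<le> 1" by (simp add: gaussian_kernel_def)
      show "0 \<le> ?l x x"
        using quad_form_low_kernel_nonneg[of "{x}" \<sigma> n "\<lambda>_. 1"] by (simp add: quad_form_def)
    qed simp
    finally show "\<bar>\<Sum>M | size M < n. w M * (orderings M * feature \<sigma> M x)\<bar> \<le> 1"
      unfolding g by (simp add: abs_square_le_1) }
qed

section \<open>Covering the unit ball by truncation\<close>

text \<open>
  Every point of \<open>X\<close> imposes a closed condition on the coefficients, and the cube is compact.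
\<close>

lemma coefficients_by_compactness:
  fixes b :: "'i \<Rightarrow> 'a \<Rightarrow> real"
  assumes "finite I" and fin: "\<And>F. finite F \<Longrightarrow> F \<subseteq> X \<Longrightarrow>
      \<exists>w. (\<forall>i\<in>I. \<bar>w i\<bar> \<le> 1) \<and> (\<forall>x\<in>F. \<bar>f x - (\<Sum>i\<in>I. w i * b i x)\<bar> \<le> \<delta> \<and> \<bar>\<Sum>i\<in>I. w i * b i x\<bar> \<le> 1)"
  shows "\<exists>w. (\<forall>i\<in>I. \<bar>w i\<bar> \<le> 1) \<and> (\<forall>x\<in>X. \<bar>f x - (\<Sum>i\<in>I. w i * b i x)\<bar> \<le> \<delta> \<and> \<bar>\<Sum>i\<in>I. w i * b i x\<bar> \<le> 1)"
proof -
  define Q where "Q = (UNIV :: 'i set) \<rightarrow>\<^sub>E {-1..1::real}"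
  define P where "P = (\<lambda>x. {w :: 'i \<Rightarrow> real. \<bar>f x - (\<Sum>i\<in>I. w i * b i x)\<bar> \<le> \<delta> \<and> \<bar>\<Sum>i\<in>I. w i * b i x\<bar> \<le> 1})"
  have "compactin (product_topology (\<lambda>_. euclidean) UNIV) Q"
    unfolding Q_def compactin_PiE by (simp add: compactin_euclidean_iff)
  then have "compact Q" by (simp add: euclidean_product_topology compactin_euclidean_iff)
  moreover have "closed (P x)" for x
    unfolding P_def
    by (intro closed_Collect_conj closed_Collect_le continuous_intros continuous_on_product_coordinates)
  moreover have "Q \<inter> (\<Inter>x\<in>F. P x) \<noteq> {}" if F: "finite F" "F \<subseteq> X" for F
  proof -
    obtain w where w: "\<forall>i\<in>I. \<bar>w i\<bar> \<le> 1"
      "\<forall>x\<in>F. \<bar>f x - (\<Sum>i\<in>I. w i * b i x)\<bar> \<le> \<delta> \<and> \<bar>\<Sum>i\<in>I. w i * b i x\<bar> \<le> 1"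
      using fin[OF F] by blast
    define w' where "w' = (\<lambda>i. if i \<in> I then w i else 0)"
    have "(\<Sum>i\<in>I. w' i * b i x) = (\<Sum>i\<in>I. w i * b i x)" for x by (simp add: w'_def)
    then have "w' \<in> (\<Inter>x\<in>F. P x)" using w(2) by (simp add: P_def)
    moreover have "w' \<in> Q" using w(1) by (auto simp: Q_def w'_def abs_le_iff)
    ultimately show ?thesis by blast
  qed
  ultimately have "Q \<inter> (\<Inter>x\<in>X. P x) \<noteq> {}" by (rule compact_imp_fip_image)
  then obtain w where w: "w \<in> Q" "\<And>x. x \<in> X \<Longrightarrow> w \<in> P x" by blast
  have "\<bar>w i\<bar> \<le> 1" for i using PiE_mem[OF w(1)[unfolded Q_def], of i] by (simp add: abs_le_iff)
  with w(2) show ?thesis by (auto simp: P_def)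
qed

lemma bounded_feature:
  fixes M :: "'d::finite multiset"
  shows "bounded (feature \<sigma> M ` cball 0 1)"
proof -
  have "continuous_on S (monomial_at M)" for S
    unfolding monomial_at_def[abs_def]
    by (induction M) (auto intro!: continuous_intros)
  then have "continuous_on (cball 0 1) (feature \<sigma> M)"
    unfolding feature_def[abs_def] by (intro continuous_intros) auto
  then show ?thesis by (intro compact_imp_bounded compact_continuous_image compact_cball)
qed

lemma log_covering_number_leI:
  assumes "finite S" "S \<noteq> {}" "S \<subseteq> F"
    and cover: "\<And>f. f \<in> T ` unit_ball E nE \<Longrightarrow> \<exists>h\<in>S. \<exists>b\<in>unit_ball F nF. f = h + \<epsilon> *\<^sub>R b"
    and card: "ln (real (card S)) \<le> C"
  shows "log_covering_number E nE F nF T \<epsilon> \<le> ereal C"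
proof -
  let ?A = "T ` unit_ball E nE"
  define N where "N = {enat n | n. n \<ge> 1 \<and> (\<exists>x. (\<forall>i\<in>{1..n}. x i \<in> F) \<and>
        ?A \<subseteq> (\<Union>i\<in>{1..n}. {x i + \<epsilon> *\<^sub>R b | b. b \<in> unit_ball F nF}))}"
  have c1: "card S \<ge> 1" using assms(1,2) by (simp add: Suc_leI card_gt_0_iff)
  obtain x where x: "bij_betw x {1..card S} S" using ex_bij_betw_nat_finite_1[OF assms(1)] by blast
  have "?A \<subseteq> (\<Union>i\<in>{1..card S}. {x i + \<epsilon> *\<^sub>R b | b. b \<in> unit_ball F nF})"
  proof
    fix f assume "f \<in> ?A"
    then obtain h b where "h \<in> S" and b: "b \<in> unit_ball F nF" "f = h + \<epsilon> *\<^sub>R b" using cover by blast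
    then obtain i where "i \<in> {1..card S}" "h = x i" using x unfolding bij_betw_def by blast
    with b show "f \<in> (\<Union>i\<in>{1..card S}. {x i + \<epsilon> *\<^sub>R b | b. b \<in> unit_ball F nF})" by blast
  qed
  moreover have "\<forall>i\<in>{1..card S}. x i \<in> F" using x assms(3) by (auto simp: bij_betw_def)
  ultimately have mem: "enat (card S) \<in> N" unfolding N_def using c1 by blast
  have cov: "covering_number F nF ?A \<epsilon> = Inf N" by (simp add: covering_number_def N_def)
  have "Inf N \<in> N" using mem by (metis empty_iff Inf_enat_def LeastI)
  then obtain n where n: "Inf N = enat n" "n \<ge> 1" by (auto simp: N_def)
  have "Inf N \<le> enat (card S)" by (rule Inf_lower[OF mem])
  then have "n \<le> card S" by (simp add: n)
  then have "ln (real n) \<le> C" using n(2) card by (meson ln_mono le_less_trans of_nat_0_less_iff of_nat_le_iff order_trans less_le_trans zero_less_one)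
  then show ?thesis by (simp add: log_covering_number_def cov n)
qed

text \<open>
  The radius is split as \<open>\<epsilon> / 4\<close> for the truncation and \<open>3 * \<epsilon> / 4\<close> for the net, for which
  \<open>1 + 2 / (3 * \<epsilon> / 4) \<le> 4 / \<epsilon>\<close>.
\<close>

lemma log_covering_number_gaussian_le:
  fixes H :: "(real ^ 'd::finite \<Rightarrow> real) set"
  assumes H: "rkhs (cball 0 1) (gaussian_kernel \<sigma>) H ip"
    and eps: "0 < \<epsilon>" "\<epsilon> \<le> 1"
    and tail: "(2 * \<sigma>\<^sup>2) ^ n / fact n \<le> (\<epsilon> / 4)\<^sup>2"
  shows "log_covering_number H (ip_norm ip) (linf (cball 0 1)) (linf_norm (cball 0 1)) id \<epsilon>
    \<le> ereal (real (card {M :: 'd multiset. size M < n}) * ln (4 / \<epsilon>))"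
proof -
  interpret rkhs "cball 0 1" "gaussian_kernel \<sigma>" H ip by (rule H)
  let ?X = "cball 0 1 :: (real ^ 'd) set"
  define I where "I = {M :: 'd multiset. size M < n}"
  have finI: "finite I" unfolding I_def by (rule finite_multisets_below)
  define b where "b = (\<lambda>M x. if x \<in> ?X then orderings M * feature \<sigma> M x else 0)"
  have b_bounded: "bounded (b M ` ?X)" for M
  proof -
    have "b M ` ?X = (\<lambda>r. orderings M *\<^sub>R r) ` (feature \<sigma> M ` ?X)" by (auto simp: b_def image_image)
    then show ?thesis by (simp only:) (intro bounded_scaling bounded_feature)
  qed
  define A where "A = {g. (\<forall>x\<in>?X. \<bar>g x\<bar> \<le> 1) \<and> (\<exists>w. (\<forall>M\<in>I. \<bar>w M\<bar> \<le> 1) \<and> g = (\<lambda>x. \<Sum>M\<in>I. w M * b M x))}"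
  have A_linf: "A \<subseteq> linf ?X"
  proof
    fix g assume g: "g \<in> A"
    then have "g \<in> functions_on ?X" by (auto simp: A_def functions_on_def b_def)
    moreover have "bounded (g ` ?X)" using g by (auto simp: A_def bounded_iff)
    ultimately show "g \<in> linf ?X" by (simp add: linf_def)
  qed
  have approx: "\<exists>g\<in>A. \<forall>x\<in>?X. \<bar>f x - g x\<bar> \<le> \<epsilon> / 4" if f: "f \<in> unit_ball H (ip_norm ip)" for f
  proof -
    have "\<exists>w. (\<forall>M\<in>I. \<bar>w M\<bar> \<le> 1) \<and>
        (\<forall>x\<in>F. \<bar>f x - (\<Sum>M\<in>I. w M * b M x)\<bar> \<le> \<epsilon> / 4 \<and> \<bar>\<Sum>M\<in>I. w M * b M x\<bar> \<le> 1)"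
      if F: "finite F" "F \<subseteq> ?X" for F
    proof -
      obtain c where c: "\<And>x. x \<in> F \<Longrightarrow> f x = (\<Sum>z\<in>F. c z * gaussian_kernel \<sigma> z x)"
        and q: "quad_form F (gaussian_kernel \<sigma>) c \<le> 1" using unit_ball_on_finite[OF F f] by blast
      have pos: "0 \<le> \<epsilon> / 4" using eps by simp
      note approx = finite_feature_approximation[OF F q tail pos c]
      define w where "w = (\<lambda>M. \<Sum>z\<in>F. c z * feature \<sigma> M z)"
      have b_eq: "(\<Sum>M\<in>I. w M * b M x) = (\<Sum>M | size M < n. w M * (orderings M * feature \<sigma> M x))" if "x \<in> F" for x
        using that F by (auto simp: b_def I_def)
      have "\<forall>M\<in>I. \<bar>w M\<bar> \<le> 1" using approx(1) by (simp add: I_def w_def)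
      moreover have "\<bar>f x - (\<Sum>M\<in>I. w M * b M x)\<bar> \<le> \<epsilon> / 4 \<and> \<bar>\<Sum>M\<in>I. w M * b M x\<bar> \<le> 1" if x: "x \<in> F" for x
        unfolding b_eq[OF x] using approx(2,3)[OF _ x] by (simp add: w_def)
      ultimately show ?thesis by blast
    qed
    from coefficients_by_compactness[OF finI this]
    obtain w where w: "\<forall>M\<in>I. \<bar>w M\<bar> \<le> 1"
      "\<forall>x\<in>?X. \<bar>f x - (\<Sum>M\<in>I. w M * b M x)\<bar> \<le> \<epsilon> / 4 \<and> \<bar>\<Sum>M\<in>I. w M * b M x\<bar> \<le> 1" by blast
    then show ?thesis by (intro bexI[of _ "\<lambda>x. \<Sum>M\<in>I. w M * b M x"]) (auto simp: A_def)
  qed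
  have "0 < 3 * \<epsilon> / 4" using eps by simp
  from finite_net_in_span[of I b, OF finI b_bounded this, folded A_def]
  obtain S where S_net: "S \<subseteq> A \<and> finite S \<and> S \<noteq> {} \<and> real (card S) \<le> (1 + 2 / (3 * \<epsilon> / 4)) ^ card I \<and>
      (\<forall>g\<in>A. \<exists>h\<in>S. \<forall>x\<in>?X. \<bar>g x - h x\<bar> \<le> 3 * \<epsilon> / 4)" by (rule exE)
  then have S: "S \<subseteq> A" "finite S" "S \<noteq> {}" "real (card S) \<le> (1 + 2 / (3 * \<epsilon> / 4)) ^ card I" by simp_all
  have net: "\<exists>h\<in>S. \<forall>x\<in>?X. \<bar>g x - h x\<bar> \<le> 3 * \<epsilon> / 4" if "g \<in> A" for g
    using S_net that by simp
  show ?thesis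
  proof (rule log_covering_number_leI[OF S(2,3)])
    show "S \<subseteq> linf ?X" using S A_linf by blast
    fix f assume "f \<in> id ` unit_ball H (ip_norm ip)"
    then have f: "f \<in> unit_ball H (ip_norm ip)" by simp
    obtain g where g: "g \<in> A" "\<forall>x\<in>?X. \<bar>f x - g x\<bar> \<le> \<epsilon> / 4" using approx[OF f] by blast
    obtain h where h: "h \<in> S" "\<forall>x\<in>?X. \<bar>g x - h x\<bar> \<le> 3 * \<epsilon> / 4" using net[OF g(1)] by blast
    define r where "r = (\<lambda>x. (f x - h x) / \<epsilon>)"
    have r1: "\<bar>r x\<bar> \<le> 1" if "x \<in> ?X" for x
    proof -
      have "\<bar>f x - g x\<bar> \<le> \<epsilon> / 4" "\<bar>g x - h x\<bar> \<le> 3 * \<epsilon> / 4" using g h that by blast+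
      then have "\<bar>f x - h x\<bar> \<le> \<epsilon>" by linarith
      then show ?thesis using eps by (simp add: r_def)
    qed
    have "f \<in> functions_on ?X" using f vanish_off by (auto simp: unit_ball_def)
    moreover have "h \<in> functions_on ?X" using h S A_linf by (auto simp: linf_def)
    ultimately have "r \<in> functions_on ?X" by (simp add: functions_on_def r_def)
    moreover have "bounded (r ` ?X)" using r1 by (auto simp: bounded_iff intro!: exI[of _ 1])
    moreover have "linf_norm ?X r \<le> 1"
      unfolding linf_norm_def using r1 by (intro cSUP_least) auto
    ultimately have "r \<in> unit_ball (linf ?X) (linf_norm ?X)" by (simp add: unit_ball_def linf_def)
    moreover have "f = h + \<epsilon> *\<^sub>R r" using eps by (auto simp: r_def scaleR_fun_def fun_eq_iff)
    ultimately show "\<exists>h\<in>S. \<exists>b\<in>unit_ball (linf ?X) (linf_norm ?X). f = h + \<epsilon> *\<^sub>R b" using h(1) by blast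
  next
    have "1 + 2 / (3 * \<epsilon> / 4) \<le> 4 / \<epsilon>" using eps by (simp add: field_simps)
    then have "(1 + 2 / (3 * \<epsilon> / 4)) ^ card I \<le> (4 / \<epsilon>) ^ card I" using eps by (intro power_mono) auto
    with S(4) have le: "real (card S) \<le> (4 / \<epsilon>) ^ card I" by (rule order_trans)
    have pos: "0 < real (card S)" using S(2,3) by (simp add: card_gt_0_iff)
    have "ln (real (card S)) \<le> ln ((4 / \<epsilon>) ^ card I)"
      using le by (simp only: ln_le_cancel_iff[OF pos less_le_trans[OF pos le]])
    also have "\<dots> = real (card I) * ln (4 / \<epsilon>)" using eps by (simp add: ln_realpow)
    finally show "ln (real (card S)) \<le> real (card {M :: 'd multiset. size M < n}) * ln (4 / \<epsilon>)"
      by (simp add: I_def)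
  qed
qed

section \<open>Choosing the degree\<close>

lemma lambert_W_pos:
  assumes "0 < a"
  shows "0 < lambert_W a" and "lambert_W a * exp (lambert_W a) = a"
proof -
  have inj: "inj_on (\<lambda>t::real. t * exp t) {-1..}"
  proof (rule linorder_inj_onI)
    fix s t :: real assume st: "s < t" "s \<in> {-1..}"
    have "s * exp s < t * exp t"
    proof (rule DERIV_pos_imp_increasing_open[OF st(1)])
      fix x assume "s < x" "x < t"
      then have "0 < (1 + x) * exp x" using st by simp
      moreover have "((\<lambda>t. t * exp t) has_real_derivative (1 + x) * exp x) (at x)"
        by (auto intro!: derivative_eq_intros simp: algebra_simps)
      ultimately show "\<exists>y. ((\<lambda>t. t * exp t) has_real_derivative y) (at x) \<and> 0 < y" by blast
    qed (intro continuous_intros)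
    then show "s * exp s \<noteq> t * exp t" by simp
  qed auto
  have "\<exists>w\<ge>0. w \<le> a \<and> w * exp w = a"
  proof (rule IVT')
    show "a \<le> a * exp a" using assms by simp
  qed (use assms in \<open>auto intro!: continuous_intros\<close>)
  then obtain w where w: "0 \<le> w" "w * exp w = a" by blast
  have "lambert_W (w * exp w) = w"
    unfolding lambert_W_def using the_inv_into_f_f[OF inj, of w] w by simp
  then have "lambert_W a = w" using w by simp
  with w assms show "0 < lambert_W a" "lambert_W a * exp (lambert_W a) = a"
    by (auto simp: less_le)
qed

lemma power_le_exp_mult_fact: "real n ^ n \<le> exp (real n) * fact n"
proof -
  have "real n ^ n / fact n \<le> exp (real n)"
    using sum_le_suminf[OF summable_exp, of "{n}" "real n"] by (simp add: exp_def divide_inverse mult.commute)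
  then show ?thesis by (simp add: field_simps)
qed

lemma ln_le_powr_div:
  fixes q y :: real
  assumes "0 < q" "0 < y"
  shows "ln y \<le> y powr q / (exp 1 * q)"
proof -
  have "exp 1 * (q * ln y) \<le> exp (q * ln y)"
    using exp_ge_add_one_self[of "q * ln y - 1"] by (simp add: exp_diff field_simps)
  then show ?thesis using assms by (simp add: powr_def field_simps)
qed

text \<open>
  By \<open>n! \<ge> (n / e)\<^sup>n\<close> it suffices that \<open>n * ln (n / (2 * e * \<sigma>\<^sup>2)) \<ge> 2 * ln y\<close>, and the left side
  increases in \<open>n\<close> where the logarithm is nonnegative, so it is enough to consider \<open>t\<close>. Since
  \<open>1 / \<sigma>\<^sup>2 = q * W * exp W\<close>, for \<open>v = q * ln y\<close> and \<open>z = 1 / W + v\<close> the logarithm at \<open>t\<close> is exactly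
  \<open>z + W - 2\<close>. With \<open>exp (z - 1) \<ge> z\<close> the claim reduces to \<open>z * (z + W - 2) \<ge> W * v = W * z - 1\<close>,
  which is \<open>(z - 1)\<^sup>2 \<ge> 0\<close>.
\<close>

lemma taylor_tail_le_power_minus:
  fixes \<sigma> q y t :: real
  defines "W \<equiv> lambert_W (1 / (q * \<sigma>\<^sup>2))"
  assumes "\<sigma> > 0" "q > 0" "1 \<le> y"
    and t: "t = 2 / (exp 1 * q * W) * exp (1 / W) * y powr q" and n: "t \<le> real n"
  shows "(2 * \<sigma>\<^sup>2) ^ n / fact n \<le> (1 / y)\<^sup>2"
proof -
  have W: "0 < W" "W * exp W = 1 / (q * \<sigma>\<^sup>2)"
    using lambert_W_pos[of "1 / (q * \<sigma>\<^sup>2)"] assms by (simp_all add: W_def)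
  define v where "v = q * ln y"
  define z where "z = 1 / W + v"
  have "0 \<le> v" using assms by (simp add: v_def)
  have t_pos: "0 < t" using assms W by (simp add: t)
  have n_pos: "0 < real n" using t_pos n by linarith
  have \<sigma>: "\<sigma>\<^sup>2 = 1 / (q * W * exp W)" using W assms by (simp add: field_simps)
  have yv: "y powr q = exp v" using assms by (simp add: powr_def v_def)
  have t': "t = 2 / (q * W) * exp (z - 1)"
    by (simp add: t yv z_def exp_add exp_diff field_simps)
  have "t / (2 * exp 1 * \<sigma>\<^sup>2) = exp (z + W - 2)"
  proof -
    have "t / (2 * exp 1 * \<sigma>\<^sup>2) = exp (z - 1) * exp W / exp 1"
      using W(1) assms(3) by (simp add: t' \<sigma>)
    also have "\<dots> = exp (z + W - 2)" by (simp flip: exp_add exp_diff)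
    finally show ?thesis .
  qed
  then have ln_t: "ln (t / (2 * exp 1 * \<sigma>\<^sup>2)) = z + W - 2" by simp
  have key: "0 \<le> z + W - 2"
  proof -
    have "0 \<le> (W - 1)\<^sup>2 / W" using W by simp
    also have "\<dots> = 1 / W + W - 2" using W by (simp add: power2_eq_square field_simps)
    finally show ?thesis using \<open>0 \<le> v\<close> by (simp add: z_def)
  qed
  have "2 * v \<le> (2 / W) * (z * (z + W - 2))"
  proof -
    have "W * v = W * z - 1" using W by (simp add: z_def field_simps)
    also have "\<dots> \<le> z * (z + W - 2)" using sum_squares_ge_zero[of "z - 1" 0] by (simp add: algebra_simps)
    finally show ?thesis using W by (simp add: field_simps)
  qed
  also have "\<dots> \<le> (2 / W) * (exp (z - 1) * (z + W - 2))"
    using exp_ge_add_one_self[of "z - 1"] W key by (intro mult_left_mono mult_right_mono) auto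
  finally have "2 * v \<le> q * (t * (z + W - 2))" using assms(3) by (simp add: t')
  then have "2 * ln y \<le> t * (z + W - 2)" using assms(3) by (simp add: v_def)
  also have "\<dots> \<le> real n * ln (real n / (2 * exp 1 * \<sigma>\<^sup>2))"
  proof (rule mult_mono[OF n])
    show "z + W - 2 \<le> ln (real n / (2 * exp 1 * \<sigma>\<^sup>2))"
      using n t_pos n_pos assms(2) by (subst ln_t[symmetric]) (simp add: divide_right_mono)
  qed (use n_pos key in auto)
  finally have le: "exp (2 * ln y) \<le> exp (real n * ln (real n / (2 * exp 1 * \<sigma>\<^sup>2)))" by simp
  have "y\<^sup>2 = exp (2 * ln y)" using assms(4) by (simp add: exp_double)
  also note le
  also have "exp (real n * ln (real n / (2 * exp 1 * \<sigma>\<^sup>2))) = (real n / (2 * exp 1 * \<sigma>\<^sup>2)) ^ n"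
    using n_pos assms(2) by (simp add: exp_of_nat_mult)
  also have "\<dots> = real n ^ n / ((2 * \<sigma>\<^sup>2) ^ n * exp (real n))"
    using exp_of_nat_mult[of n "1::real"] by (simp add: power_divide power_mult_distrib mult_ac)
  also have "\<dots> \<le> (exp (real n) * fact n) / ((2 * \<sigma>\<^sup>2) ^ n * exp (real n))"
    by (intro divide_right_mono power_le_exp_mult_fact) simp
  also have "\<dots> = fact n / (2 * \<sigma>\<^sup>2) ^ n" by simp
  finally show ?thesis using assms(2,4) by (simp add: field_simps power_divide)
qed

theorem theorem2p3:
  fixes \<sigma> p \<epsilon> t0 :: real and d :: nat
    and H :: "(real ^ 'd \<Rightarrow> real) set"
    and ip :: "(real ^ 'd \<Rightarrow> real) \<Rightarrow> (real ^ 'd \<Rightarrow> real) \<Rightarrow> real"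
  assumes d: "d = CARD('d)"
    and "\<sigma> > 0" and "p > 0" and "0 < \<epsilon>" and "\<epsilon> \<le> 1"
    and t0: "t0 = 2 * (real d + 1) * 4 powr (p / (real d + 1)) /
        (exp 1 * p * lambert_W ((real d + 1) / (p * \<sigma>\<^sup>2))) *
        exp (1 / lambert_W ((real d + 1) / (p * \<sigma>\<^sup>2)))"
    and H: "rkhs (cball 0 1) (gaussian_kernel \<sigma>) H ip"
  shows "log_covering_number H (ip_norm ip) (linf (cball 0 1)) (linf_norm (cball 0 1)) id \<epsilon>
    \<le> ereal (gen_binomial t0 d * ((real d + 1) / (exp 1 * p)) * 4 powr (p / (real d + 1)) *
        \<epsilon> powr (- p))"
proof -
  define q where "q = p / (real d + 1)"
  define c where "c = \<epsilon> powr (- q)"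
  define W where "W = lambert_W (1 / (q * \<sigma>\<^sup>2))"
  have q: "0 < q" using \<open>p > 0\<close> by (simp add: q_def)
  have W_eq: "lambert_W ((real d + 1) / (p * \<sigma>\<^sup>2)) = W" by (simp add: W_def q_def)
  have W: "0 < W" using lambert_W_pos(1)[of "1 / (q * \<sigma>\<^sup>2)"] q \<open>\<sigma> > 0\<close> by (simp add: W_def)
  have t0_eq: "t0 = 2 / (exp 1 * q * W) * exp (1 / W) * 4 powr q"
    unfolding t0 W_eq by (simp add: q_def)
  have t0_pos: "0 \<le> t0" using q W by (simp add: t0_eq)
  have powr_eps: "(4 / \<epsilon>) powr q = 4 powr q * c"
    using \<open>0 < \<epsilon>\<close> by (simp add: c_def powr_divide powr_minus_divide)
  have c1: "1 \<le> c" using powr_mono2'[of "- q" \<epsilon> 1] q assms(4,5) by (simp add: c_def)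
  \<comment> \<open>Degrees \<open>0\<close> to \<open>m\<close> are kept, so the truncation error is that of \<open>n = Suc m \<ge> c * t0\<close>.\<close>
  define m where "m = nat \<lfloor>c * t0\<rfloor>"
  have m: "real m \<le> c * t0" "c * t0 \<le> real (Suc m)"
    using c1 t0_pos by (simp_all add: m_def) linarith+
  have "(2 * \<sigma>\<^sup>2) ^ Suc m / fact (Suc m) \<le> (1 / (4 / \<epsilon>))\<^sup>2"
  proof (rule taylor_tail_le_power_minus[OF \<open>\<sigma> > 0\<close> q _ refl])
    show "1 \<le> 4 / \<epsilon>" using assms(4,5) by simp
    show "2 / (exp 1 * q * lambert_W (1 / (q * \<sigma>\<^sup>2))) * exp (1 / lambert_W (1 / (q * \<sigma>\<^sup>2))) * (4 / \<epsilon>) powr q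
        \<le> real (Suc m)"
      using m(2) by (simp add: t0_eq powr_eps mult_ac flip: W_def)
  qed
  then have "(2 * \<sigma>\<^sup>2) ^ Suc m / fact (Suc m) \<le> (\<epsilon> / 4)\<^sup>2" by simp
  from log_covering_number_gaussian_le[OF H assms(4,5) this]
  have "log_covering_number H (ip_norm ip) (linf (cball 0 1)) (linf_norm (cball 0 1)) id \<epsilon>
      \<le> ereal (real ((m + d) choose d) * ln (4 / \<epsilon>))" by (simp add: card_multisets_below d)
  also have "\<dots> \<le> ereal ((c ^ d * gen_binomial t0 d) * (4 powr q * c / (exp 1 * q)))"
    unfolding ereal_less_eq
  proof (rule mult_mono)
    have "real ((m + d) choose d) \<le> gen_binomial (c * t0) d"
      unfolding gen_binomial_of_nat[symmetric] by (rule gen_binomial_mono) (use m in auto)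
    also have "\<dots> \<le> c ^ d * gen_binomial t0 d" by (rule gen_binomial_scale_le[OF t0_pos c1])
    finally show le: "real ((m + d) choose d) \<le> c ^ d * gen_binomial t0 d" .
    show "0 \<le> c ^ d * gen_binomial t0 d" using le by (rule order_trans[rotated]) simp
    show "ln (4 / \<epsilon>) \<le> 4 powr q * c / (exp 1 * q)"
      using ln_le_powr_div[OF q, of "4 / \<epsilon>"] assms(4) by (simp add: powr_eps)
    show "0 \<le> ln (4 / \<epsilon>)" using assms(4,5) by simp
  qed
  also have "(c ^ d * gen_binomial t0 d) * (4 powr q * c / (exp 1 * q))
      = gen_binomial t0 d * ((real d + 1) / (exp 1 * p)) * 4 powr q * c ^ Suc d"
    by (simp add: q_def)
  also have "c ^ Suc d = \<epsilon> powr (- p)"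
  proof -
    have "c ^ Suc d = \<epsilon> powr (- q * real (Suc d))" unfolding c_def
      using assms(4) by (simp only: powr_powr powr_realpow[symmetric] powr_gt_zero)
    also have "- q * real (Suc d) = - p" by (simp add: q_def add.commute)
    finally show ?thesis .
  qed
  finally show ?thesis by (simp only: q_def)
qed

end
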